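(* Let $(X,d)$ be a complete length space and $T>0$. Assume that $f:X\to\mathbb{R}$ is bounded and continuous. Let $u_0:X\to\mathbb{R}$ be bounded and Lipschitz and let $u\in C(X\times[0,T))$ satisfy $\sup_{x\in X}|u(x,t)-u_0(x)|\to0$ as $t\to0+$. Then $u$ is a Monge solution of $$\partial_tu+|\nabla u|=f(x)\quad\text{in }X\times(0,T)$$ if and only if it is a curve-based viscosity solution of this equation.
   Context: Write $Y_T=X\times(0,T)$. Monge solutions. For $k\ge0$, $S_k(Y_T)$ is the set of locally Lipschitz $u:Y_T\to\mathbb{R}$ with $u(x,t)-u(x,s)\ge-k(t-s)$ for all $x\in X$, $0<s<t<T$; $S(Y_T)=\bigcup_{k\ge0}S_k(Y_T)$. For $v\in S_0(Y_T)$, $$|D^-v|(x,t)=\limsup_{\delta\to0+}\ \sup\left\{\frac{v(x,t)-v(y,t-\delta)}{\delta}:y\in X,\ d(x,y)\le\delta\right\}.$$ $u$ is a Monge solution if $u\in S(Y_T)$ (restricted to $Y_T$) and there is $k\ge0$ with $k+\inf_Xf\ge0$ and $u\in S_k(Y_T)$ such that $v(x,t)=u(x,t)+kt$ satisfies $|D^-v|(x,t)=f(x)+k$ for all $(x,t)\in Y_T$. Curve-based solutions. The Hamiltonian is $H(x,p)=p-f(x)$, $p\ge0$, with Lagrangian $L(x,q)=\sup_{p\ge0}\{pq-H(x,p)\}$, i.e. $L(x,q)=f(x)$ for $0\le q\le1$ and $L(x,q)=+\infty$ for $q>1$. $\mathcal A_x(X)$ is the set of absolutely continuous curves $\gamma:[0,\infty)\to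 X$ with $\gamma(0)=x$ for which there are finitely many $r_1<\dots<r_n$ such that on each $I=[0,r_1],[r_1,r_2],\dots,[r_n,\infty)$ the metric speed $|\gamma'|$ equals a constant $v_I$ a.e. and $\sigma\mapsto L(\gamma(\sigma),v_I)$ (with values in $(-\infty,+\infty]$) is continuous on $I$. A function $u$ on $Y_T$ is arcwise continuous if $(s,t)\mapsto u(\gamma(s),t)$ is continuous on $\mathbb{R}\times(0,T)$ for every absolutely continuous $\gamma:\mathbb{R}\to X$. An arcwise continuous $u$ is a curve-based viscosity subsolution if for all $(x,t)\in Y_T$ and all $\gamma\in\mathcal A_x(X)$, $u(x,t)\le\int_0^\delta L(\gamma(\sigma),|\gamma'|(\sigma))\,d\sigma+u(\gamma(\delta),t-\delta)$ for all $\delta\in[0,t)$; a curve-based viscosity supersolution if for all $(x,t)\in Y_T$ and $\varepsilon>0$ there is $\gamma\in\mathcal A_x(X)$ with $u(x,t)\ge\int_0^\delta L(\gamma(\sigma),|\gamma'|(\sigma))\,d\sigma+u(\gamma(\delta),t-\delta)-\varepsilon$ for all $\delta\in[0,t)$; and a curve-based viscosity solution if it is both. *)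

theory Defs
  imports "HOL-Analysis.Analysis"
begin

section \<open>Length spaces and curves\<close>

definition curve_length :: "(real \<Rightarrow> 'a::metric_space) \<Rightarrow> ereal" where
  "curve_length g =
     (SUP ts \<in> {ts. sorted ts \<and> set ts \<subseteq> {0..1}}.
        ereal (\<Sum>i<length ts - 1. dist (g (ts ! i)) (g (ts ! Suc i))))"

text \<open>The infimum over the empty set is \<open>\<infinity>\<close>, so the condition includes path-connectedness.\<close>

definition length_space :: "'a::metric_space itself \<Rightarrow> bool" where
  "length_space _ \<longleftrightarrow>
     (\<forall>x y :: 'a. ereal (dist x y) =
        (INF g \<in> {g. path g \<and> pathstart g = x \<and> pathfinish g = y}. curve_length g))"

text \<open>Absolute continuity on an interval \<open>I\<close>, in the usual metric-space form, with a locally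
  integrable upper speed bound. Integrability is only local, so that curves of constant positive
  speed on an unbounded interval qualify.\<close>

definition abs_cont_curve_on :: "real set \<Rightarrow> (real \<Rightarrow> 'a::metric_space) \<Rightarrow> bool" where
  "abs_cont_curve_on I \<gamma> \<longleftrightarrow>
     (\<exists>g. (\<forall>s\<in>I. 0 \<le> g s) \<and>
          (\<forall>a\<in>I. \<forall>b\<in>I. a \<le> b \<longrightarrow>
             set_integrable lborel {a..b} g \<and>
             dist (\<gamma> a) (\<gamma> b) \<le> (LINT s:{a..b}|lborel. g s)))"

text \<open>Metric derivative of a curve \<open>\<gamma> : [0,\<infinity>) \<rightarrow> X\<close>; values at negative times are irrelevant.\<close>

definition has_metric_speed :: "(real \<Rightarrow> 'a::metric_space) \<Rightarrow> real \<Rightarrow> real \<Rightarrow> bool" where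
  "has_metric_speed \<gamma> v \<sigma> \<longleftrightarrow>
     ((\<lambda>s. dist (\<gamma> s) (\<gamma> \<sigma>) / \<bar>s - \<sigma>\<bar>) \<longlongrightarrow> v) (at \<sigma> within {0..})"

text \<open>For an absolutely continuous curve the limit exists almost everywhere; the value of
  \<open>metric_speed\<close> at the remaining times is arbitrary.\<close>

definition metric_speed :: "(real \<Rightarrow> 'a::metric_space) \<Rightarrow> real \<Rightarrow> real" where
  "metric_speed \<gamma> \<sigma> = (THE v. has_metric_speed \<gamma> v \<sigma>)"

section \<open>Monge solutions\<close>

text \<open>Functions on \<open>X \<times> (0,T)\<close> are represented by functions on \<open>'a \<times> real\<close>; none of the notions
  below depends on values outside \<open>X \<times> (0,T)\<close>.\<close>

abbreviation spacetime :: "real \<Rightarrow> ('a \<times> real) set" where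
  "spacetime T \<equiv> UNIV \<times> {0<..<T}"

definition locally_lipschitz_on ::
    "'b::metric_space set \<Rightarrow> ('b \<Rightarrow> 'c::metric_space) \<Rightarrow> bool" where
  "locally_lipschitz_on Y u \<longleftrightarrow> (\<forall>z\<in>Y. \<exists>r>0. \<exists>C. C-lipschitz_on (ball z r \<inter> Y) u)"

definition S_class :: "real \<Rightarrow> real \<Rightarrow> ('a::metric_space \<times> real \<Rightarrow> real) set" where
  "S_class T k =
     {u. locally_lipschitz_on (spacetime T) u \<and>
         (\<forall>x s t. 0 < s \<and> s < t \<and> t < T \<longrightarrow> u (x, t) - u (x, s) \<ge> - k * (t - s))}"

definition S_union :: "real \<Rightarrow> ('a::metric_space \<times> real \<Rightarrow> real) set" where
  "S_union T = (\<Union>k\<in>{0..}. S_class T k)"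

definition subslope :: "('a::metric_space \<times> real \<Rightarrow> real) \<Rightarrow> 'a \<Rightarrow> real \<Rightarrow> ereal" where
  "subslope v x t =
     Limsup (at_right 0)
       (\<lambda>\<delta>. SUP y \<in> {y. dist x y \<le> \<delta>}. ereal ((v (x, t) - v (y, t - \<delta>)) / \<delta>))"

definition Monge_solution ::
    "('a::metric_space \<Rightarrow> real) \<Rightarrow> real \<Rightarrow> ('a \<times> real \<Rightarrow> real) \<Rightarrow> bool" where
  "Monge_solution f T u \<longleftrightarrow>
     u \<in> S_union T \<and>
     (\<exists>k\<ge>0. k + (INF x. f x) \<ge> 0 \<and> u \<in> S_class T k \<and>
        (\<forall>x. \<forall>t\<in>{0<..<T}.
           subslope (\<lambda>(y, s). u (y, s) + k * s) x t = ereal (f x + k)))"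

section \<open>Curve-based viscosity solutions\<close>

definition hamiltonian :: "('a \<Rightarrow> real) \<Rightarrow> 'a \<Rightarrow> real \<Rightarrow> real" where
  "hamiltonian f x p = p - f x"

definition lagrangian :: "('a \<Rightarrow> real) \<Rightarrow> 'a \<Rightarrow> real \<Rightarrow> ereal" where
  "lagrangian f x q = (SUP p\<in>{0..}. ereal (p * q - hamiltonian f x p))"

definition piece_ok ::
    "('a::metric_space \<Rightarrow> real) \<Rightarrow> (real \<Rightarrow> 'a) \<Rightarrow> real set \<Rightarrow> bool" where
  "piece_ok f \<gamma> I \<longleftrightarrow>
     (\<exists>v\<ge>0. (AE \<sigma> in lborel. \<sigma> \<in> I \<longrightarrow> has_metric_speed \<gamma> v \<sigma>) \<and>
            continuous_on I (\<lambda>\<sigma>. lagrangian f (\<gamma> \<sigma>) v))"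

text \<open>The breakpoints are \<open>r 1 < \<dots> < r n\<close>, with the left endpoint \<open>0\<close> stored as \<open>r 0\<close>.\<close>

definition admissible_curves ::
    "('a::metric_space \<Rightarrow> real) \<Rightarrow> 'a \<Rightarrow> (real \<Rightarrow> 'a) set" where
  "admissible_curves f x =
     {\<gamma>. abs_cont_curve_on {0..} \<gamma> \<and> \<gamma> 0 = x \<and>
         (\<exists>(n::nat) r. 1 \<le> n \<and> r 0 = 0 \<and> (\<forall>i<n. r i < r (Suc i)) \<and>
            (\<forall>i<n. piece_ok f \<gamma> {r i..r (Suc i)}) \<and> piece_ok f \<gamma> {r n..})}"

text \<open>Integral of a function with values in \<open>(-\<infinity>,\<infinity>]\<close>: positive part minus negative part
  (\<open>e2ennreal\<close> truncates negative values to \<open>0\<close>). It is only used for Lagrangians bounded below on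
  bounded intervals, where the subtrahend is finite.\<close>

definition ereal_set_integral :: "real set \<Rightarrow> (real \<Rightarrow> ereal) \<Rightarrow> ereal" where
  "ereal_set_integral A h =
     enn2ereal (\<integral>\<^sup>+\<sigma>\<in>A. e2ennreal (h \<sigma>) \<partial>lborel) -
     enn2ereal (\<integral>\<^sup>+\<sigma>\<in>A. e2ennreal (- h \<sigma>) \<partial>lborel)"

definition action :: "('a::metric_space \<Rightarrow> real) \<Rightarrow> (real \<Rightarrow> 'a) \<Rightarrow> real \<Rightarrow> ereal" where
  "action f \<gamma> \<delta> =
     ereal_set_integral {0..\<delta>} (\<lambda>\<sigma>. lagrangian f (\<gamma> \<sigma>) (metric_speed \<gamma> \<sigma>))"

definition arcwise_continuous :: "real \<Rightarrow> ('a::metric_space \<times> real \<Rightarrow> real) \<Rightarrow> bool" where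
  "arcwise_continuous T u \<longleftrightarrow>
     (\<forall>\<gamma>. abs_cont_curve_on UNIV \<gamma> \<longrightarrow>
        continuous_on (UNIV \<times> {0<..<T}) (\<lambda>(s, t). u (\<gamma> s, t)))"

definition curve_based_subsolution ::
    "('a::metric_space \<Rightarrow> real) \<Rightarrow> real \<Rightarrow> ('a \<times> real \<Rightarrow> real) \<Rightarrow> bool" where
  "curve_based_subsolution f T u \<longleftrightarrow>
     arcwise_continuous T u \<and>
     (\<forall>x. \<forall>t\<in>{0<..<T}. \<forall>\<gamma>\<in>admissible_curves f x. \<forall>\<delta>\<in>{0..<t}.
        ereal (u (x, t)) \<le> action f \<gamma> \<delta> + ereal (u (\<gamma> \<delta>, t - \<delta>)))"

definition curve_based_supersolution ::
    "('a::metric_space \<Rightarrow> real) \<Rightarrow> real \<Rightarrow> ('a \<times> real \<Rightarrow> real) \<Rightarrow> bool" where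
  "curve_based_supersolution f T u \<longleftrightarrow>
     arcwise_continuous T u \<and>
     (\<forall>x. \<forall>t\<in>{0<..<T}. \<forall>\<epsilon>>0. \<exists>\<gamma>\<in>admissible_curves f x. \<forall>\<delta>\<in>{0..<t}.
        ereal (u (x, t)) \<ge> action f \<gamma> \<delta> + ereal (u (\<gamma> \<delta>, t - \<delta>)) - ereal \<epsilon>)"

definition curve_based_solution ::
    "('a::metric_space \<Rightarrow> real) \<Rightarrow> real \<Rightarrow> ('a \<times> real \<Rightarrow> real) \<Rightarrow> bool" where
  "curve_based_solution f T u \<longleftrightarrow>
     curve_based_subsolution f T u \<and> curve_based_supersolution f T u"

end

theory Submission
  imports Defs
begin

text \<open>
  The Lagrangian is \<open>f x\<close> at speeds up to one and infinite above. Hence an admissible curve of finite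
  action is \<open>1\<close>-Lipschitz, and its action is the integral of \<open>f\<close> along it. Call
  \<open>\<integral>\<^sub>0\<^sup>s f (\<gamma> r) dr + u (\<gamma> s, t - s)\<close> the cost of \<open>\<gamma>\<close> at time \<open>s\<close>. The curve-based conditions are
  the dynamic programming principle: the cost is at least its initial value \<open>u (x, t)\<close> along every
  \<open>1\<close>-Lipschitz admissible curve from \<open>x\<close>, and at most \<open>u (x, t) + \<epsilon>\<close> along a suitable one.
  The Monge equation is the infinitesimal form of this principle. The constant \<open>k\<close> cancels in its
  difference quotients, which leaves one upper and one lower bound on backward differences of \<open>u\<close>
  (\<open>subslope_eq_iff_slopes\<close>).

  Let \<open>u\<close> be a Monge solution. By the upper bound, the cost along a \<open>1\<close>-Lipschitz curve has
  nonnegative lower right derivative, so it is nondecreasing (\<open>cost_along_curve_mono\<close>); this is the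
  subsolution property. By the lower bound, from every point of spacetime there is a short step back
  in time at which the cost rises by little. A greedy concatenation of such steps comes
  arbitrarily close to time \<open>0\<close> (\<open>near_optimal_curve_exists\<close>): otherwise its endpoints converge, by
  completeness, to a point at a positive time, and the step available at that limit point could
  already have been taken shortly before it, contradicting greediness. Monotonicity of the cost turns
  the estimate at the final time into one at all earlier times. After the final time the curve
  stays where it is; this costs little because the remaining time is short and \<open>u\<close> is uniformly close
  to \<open>u0\<close>.

  Conversely, let \<open>u\<close> be a curve-based solution. Competitors that move to a nearby point and
  near-optimal curves for short times yield the two bounds on differences of \<open>u\<close>. The lower bound on
  time increments comes from the initial condition (\<open>time_derivative_bound\<close>): a near-optimal curve
  for \<open>(x, t)\<close> is also a competitor for \<open>(x, s)\<close>, and at times when both problems have the same small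
  remaining time the two positions are at distance at most \<open>t - s\<close>, where \<open>u\<close> is almost the Lipschitz
  function \<open>u0\<close>. Local Lipschitz continuity follows from this bound and the subsolution property.

  Both directions need admissible curves between given points, and in a length space these have to
  be made out of almost shortest paths. Such a path is parametrized proportionally to arclength; by
  Vitali's covering theorem it then has the right metric speed almost everywhere
  (\<open>constant_speed_curve_exists\<close>).
\<close>

section \<open>Metric speed and absolutely continuous curves\<close>

text \<open>This replaces derivative tests for functions that have no derivative: one step to the right without
decrease, however short, is enough at each point.\<close>

lemma nondecreasing_if_right_step:
  fixes F :: "real \<Rightarrow> real"
  assumes cont: "continuous_on {a..b} F" and "a \<le> b"
    and step: "\<And>s. a \<le> s \<Longrightarrow> s < b \<Longrightarrow> \<exists>s'. s < s' \<and> s' \<le> b \<and> F s \<le> F s'"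
  shows "F a \<le> F b"
proof -
  define S where "S = {s \<in> {a..b}. F a \<le> F s}"
  have "closed S"
    unfolding S_def by (intro continuous_on_closed_Collect_le continuous_on_const cont) auto
  have "a \<in> S" "bdd_above S"
    using \<open>a \<le> b\<close> by (auto simp: S_def intro: bdd_aboveI[of _ b])
  with \<open>closed S\<close> have sup: "Sup S \<in> S"
    using closed_contains_Sup by blast
  have "\<not> Sup S < b"
  proof
    assume "Sup S < b"
    then obtain s' where s': "Sup S < s'" "s' \<le> b" "F (Sup S) \<le> F s'"
      using step[of "Sup S"] sup by (auto simp: S_def)
    with sup have "s' \<in> S" by (auto simp: S_def)
    then have "s' \<le> Sup S" using \<open>bdd_above S\<close> by (rule cSup_upper)
    with s' show False by simp
  qed
  with sup show ?thesis by (auto simp: S_def)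
qed

lemma metric_speed_eq:
  assumes "has_metric_speed \<gamma> v \<sigma>" "0 \<le> \<sigma>"
  shows "metric_speed \<gamma> \<sigma> = v"
proof -
  have "at_right \<sigma> \<le> at \<sigma> within {0..}"
    by (rule at_le) (use \<open>0 \<le> \<sigma>\<close> in auto)
  then have "at \<sigma> within {0..} \<noteq> bot"
    using trivial_limit_at_right_real[of \<sigma>] by (metis bot_unique)
  then show ?thesis
    unfolding metric_speed_def using assms(1)
    by (intro the_equality) (auto simp: has_metric_speed_def intro: tendsto_unique)
qed

lemma metric_speed_le_lipschitz:
  assumes "has_metric_speed \<gamma> v \<sigma>" "0 \<le> \<sigma>" "\<sigma> < \<delta>" and lip: "C-lipschitz_on {0..\<delta>} \<gamma>"
  shows "v \<le> C"
proof (rule tendsto_upperbound)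
  have *: "at_right \<sigma> \<le> at \<sigma> within {0..}"
    by (rule at_le) (use \<open>0 \<le> \<sigma>\<close> in auto)
  show "((\<lambda>s. dist (\<gamma> s) (\<gamma> \<sigma>) / \<bar>s - \<sigma>\<bar>) \<longlongrightarrow> v) (at_right \<sigma>)"
    using assms(1) unfolding has_metric_speed_def by (rule filterlim_mono[OF _ order_refl *])
  have "eventually (\<lambda>s. s \<in> {\<sigma><..<\<delta>}) (at_right \<sigma>)"
    using \<open>\<sigma> < \<delta>\<close> by (rule eventually_at_right_real)
  then show "eventually (\<lambda>s. dist (\<gamma> s) (\<gamma> \<sigma>) / \<bar>s - \<sigma>\<bar> \<le> C) (at_right \<sigma>)"
  proof eventually_elim
    case (elim s)
    have "dist (\<gamma> s) (\<gamma> \<sigma>) \<le> C * dist s \<sigma>"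
      using lip elim \<open>0 \<le> \<sigma>\<close> by (intro lipschitz_onD) auto
    then show ?case using elim by (simp add: dist_real_def field_simps)
  qed
qed simp

lemma abs_cont_curve_continuous_on:
  fixes \<gamma> :: "real \<Rightarrow> 'a::metric_space"
  assumes ac: "abs_cont_curve_on I \<gamma>" and sub: "{a..b} \<subseteq> I"
  shows "continuous_on {a..b} \<gamma>"
proof (cases "a \<le> b")
  case True
  obtain g where g: "(\<forall>s\<in>I. 0 \<le> g s) \<and> (\<forall>a\<in>I. \<forall>b\<in>I. a \<le> b \<longrightarrow>
      set_integrable lborel {a..b} g \<and> dist (\<gamma> a) (\<gamma> b) \<le> (LINT s:{a..b}|lborel. g s))"
    using ac unfolding abs_cont_curve_on_def ..
  have gint: "set_integrable lborel {c..d} g" and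
    gdist: "dist (\<gamma> c) (\<gamma> d) \<le> (LINT s:{c..d}|lborel. g s)" if "a \<le> c" "c \<le> d" "d \<le> b" for c d
    using conjunct2[OF g, rule_format, of c d] that subsetD[OF sub, of c] subsetD[OF sub, of d]
    by auto
  have gon: "g integrable_on {a..b}"
    using set_borel_integral_eq_integral(1)[OF gint[of a b]] True by simp
  have cont: "continuous_on {a..b} (\<lambda>x. integral {a..x} g)"
    by (rule indefinite_integral_continuous_1[OF gon])
  have le: "dist (\<gamma> c) (\<gamma> d) \<le> dist (integral {a..c} g) (integral {a..d} g)"
    if "a \<le> c" "c \<le> d" "d \<le> b" for c d
  proof -
    have "integral {a..d} g = integral {a..c} g + integral {c..d} g"
      using that by (intro Henstock_Kurzweil_Integration.integral_combine[symmetric]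
        integrable_on_subinterval[OF gon]) auto
    moreover have "dist (\<gamma> c) (\<gamma> d) \<le> integral {c..d} g"
      using gdist[of c d] set_borel_integral_eq_integral(2)[OF gint[of c d]] that by simp
    ultimately show ?thesis by (simp add: dist_real_def)
  qed
  have le': "dist (\<gamma> c) (\<gamma> d) \<le> dist (integral {a..c} g) (integral {a..d} g)"
    if "c \<in> {a..b}" "d \<in> {a..b}" for c d
    using le[of c d] le[of d c] that by (cases "c \<le> d") (auto simp: dist_commute)
  show ?thesis
    unfolding continuous_on_iff
  proof (intro ballI allI impI)
    fix x \<epsilon> :: real assume x: "x \<in> {a..b}" and "\<epsilon> > 0"
    with cont obtain d where "d > 0" and d: "\<And>x'. x' \<in> {a..b} \<Longrightarrow> dist x' x < d \<Longrightarrow>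
        dist (integral {a..x'} g) (integral {a..x} g) < \<epsilon>"
      unfolding continuous_on_iff by metis
    show "\<exists>d>0. \<forall>x'\<in>{a..b}. dist x' x < d \<longrightarrow> dist (\<gamma> x') (\<gamma> x) < \<epsilon>"
    proof (intro exI[of _ d] conjI ballI impI)
      fix x' assume "x' \<in> {a..b}" "dist x' x < d"
      then show "dist (\<gamma> x') (\<gamma> x) < \<epsilon>"
        using le'[of x' x] x d[of x'] by simp
    qed (use \<open>d > 0\<close> in simp)
  qed
qed simp

text \<open>The bound on the speed fails on a null set, which could hide a Cantor-like increase. Absolute
continuity excludes this: the null set has an open neighbourhood \<open>U\<close> over which the speed bound \<open>g\<close>
has a small integral. At points of the null set the distance from \<open>\<gamma> a\<close> grows no faster than the
integral of \<open>g\<close> over \<open>U\<close>, and at the other points no faster than the speed allows.\<close>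

lemma abs_cont_curve_lipschitz:
  fixes \<gamma> :: "real \<Rightarrow> 'a::metric_space"
  assumes ac: "abs_cont_curve_on {0..} \<gamma>" and "0 \<le> a" "a \<le> b" "0 \<le> C"
    and speed: "AE \<sigma> in lborel. a \<le> \<sigma> \<and> \<sigma> < b \<longrightarrow> (\<exists>v\<le>C. has_metric_speed \<gamma> v \<sigma>)"
  shows "dist (\<gamma> a) (\<gamma> b) \<le> C * (b - a)"
proof (rule field_le_epsilon)
  fix e0 :: real assume "e0 > 0"
  define e where "e = e0 / (b - a + 1)"
  have "e > 0" using \<open>e0 > 0\<close> \<open>a \<le> b\<close> by (simp add: e_def)
  obtain g where g: "(\<forall>s\<in>{0..}. 0 \<le> g s) \<and> (\<forall>a\<in>{0..}. \<forall>b\<in>{0..}. a \<le> b \<longrightarrow>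
      set_integrable lborel {a..b} g \<and> dist (\<gamma> a) (\<gamma> b) \<le> (LINT s:{a..b}|lborel. g s))"
    using ac unfolding abs_cont_curve_on_def ..
  then have g0: "0 \<le> g s" if "0 \<le> s" for s
    using that by simp
  have gint: "set_integrable lborel {c..d} g" and
    gdist: "dist (\<gamma> c) (\<gamma> d) \<le> (LINT s:{c..d}|lborel. g s)" if "0 \<le> c" "c \<le> d" for c d
    using conjunct2[OF g, rule_format, of c d] that by auto
  define G where "G s = indicator {a..b} s * g s" for s
  have G: "integrable lborel G"
    using gint[of a b] \<open>0 \<le> a\<close> \<open>a \<le> b\<close> unfolding G_def set_integrable_def by simp
  have G0: "0 \<le> G s" for s using g0[of s] \<open>0 \<le> a\<close> by (auto simp: G_def indicator_def)
  obtain N where N: "N \<in> null_sets lborel"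
    and N': "\<And>\<sigma>. \<sigma> \<in> space lborel - N \<Longrightarrow>
      a \<le> \<sigma> \<and> \<sigma> < b \<longrightarrow> (\<exists>v\<le>C. has_metric_speed \<gamma> v \<sigma>)"
    using AE_E3[OF speed] by metis
  have Nspeed: "\<exists>v\<le>C. has_metric_speed \<gamma> v \<sigma>" if "\<sigma> \<notin> N" "a \<le> \<sigma>" "\<sigma> < b" for \<sigma>
    using N'[of \<sigma>] that by simp
  \<comment> \<open>The measure with density \<open>G\<close> is finite, hence outer regular, and \<open>N\<close> is null for it.\<close>
  obtain U where U: "open U" "N \<subseteq> U" and Usmall: "(LINT s:U|lborel. G s) \<le> e"
  proof -
    define M where "M = density lborel (\<lambda>s. ennreal (G s))"
    have [measurable]: "G \<in> borel_measurable borel" using G by auto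
    have emM: "emeasure M A = ennreal (LINT s:A|lborel. G s)" if "A \<in> sets borel" for A
      using that G G0 integrable_mult_indicator[OF _ G, of A]
      by (auto simp: M_def emeasure_density set_lebesgue_integral_def mult.commute
          ennreal_indicator[symmetric] ennreal_mult''[symmetric] nn_integral_eq_integral)
    have "emeasure M (space M) \<noteq> \<infinity>"
      using emM[of UNIV] by (simp add: M_def)
    moreover have "N \<in> sets borel" using N by auto
    moreover have "emeasure M N = 0"
      using N absolutely_continuousI_density[of "\<lambda>s. ennreal (G s)" lborel]
      by (auto simp: M_def absolutely_continuous_def)
    ultimately have "(INF U\<in>{U. N \<subseteq> U \<and> open U}. emeasure M U) = 0"
      using outer_regular[of M N] by (simp add: M_def)
    then obtain U where U: "N \<subseteq> U" "open U" "emeasure M U < ennreal e"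
      using \<open>e > 0\<close> by (metis (no_types, lifting) INF_less_iff ennreal_less_zero_iff mem_Collect_eq)
    with emM[of U] have "(LINT s:U|lborel. G s) \<le> e"
      using \<open>e > 0\<close> by (simp add: ennreal_less_iff set_lebesgue_integral_def G0)
    with U show ?thesis by (intro that) auto
  qed
  define \<Psi> where "\<Psi> s = integral {a..s} (\<lambda>\<sigma>. indicator U \<sigma> * G \<sigma>)" for s
  have UGint: "integrable lborel (\<lambda>\<sigma>. indicator U \<sigma> * G \<sigma>)"
    using integrable_mult_indicator[OF _ G, of U] U by simp
  have UGon: "(\<lambda>\<sigma>. indicator U \<sigma> * G \<sigma>) integrable_on {c..d}" for c d
    by (rule integrable_on_subinterval[OF integrable_on_lborel[OF UGint]]) auto
  define F where "F s = (C + e) * (s - a) + \<Psi> s - dist (\<gamma> a) (\<gamma> s)" for s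
  have \<gamma>cont: "continuous_on {a..b} \<gamma>"
    using ac \<open>0 \<le> a\<close> by (intro abs_cont_curve_continuous_on[of "{0..}"]) auto
  have "F a \<le> F b"
  proof (rule nondecreasing_if_right_step[where F = F])
    show "continuous_on {a..b} F"
      unfolding F_def \<Psi>_def
      by (intro continuous_intros \<gamma>cont indefinite_integral_continuous_1 UGon)
    fix s assume s: "a \<le> s" "s < b"
    have mono: "F s \<le> F s'" if "s < s'" "s' \<le> b" 
      and "dist (\<gamma> s) (\<gamma> s') \<le> (C + e) * (s' - s) + integral {s..s'} (\<lambda>\<sigma>. indicator U \<sigma> * G \<sigma>)" for s'
    proof -
      have "\<Psi> s' = \<Psi> s + integral {s..s'} (\<lambda>\<sigma>. indicator U \<sigma> * G \<sigma>)"
        unfolding \<Psi>_def using that s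
        by (intro Henstock_Kurzweil_Integration.integral_combine[symmetric] UGon) auto
      with that(3) dist_triangle[of "\<gamma> a" "\<gamma> s'" "\<gamma> s"] show ?thesis
        by (simp add: F_def algebra_simps)
    qed
    have nn: "0 \<le> integral {s..s'} (\<lambda>\<sigma>. indicator U \<sigma> * G \<sigma>)" for s'
      by (rule integral_nonneg[OF UGon]) (simp add: G0)
    show "\<exists>s'. s < s' \<and> s' \<le> b \<and> F s \<le> F s'"
    proof (cases "s \<in> N")
      case True
      then obtain d where d: "d > 0" "ball s d \<subseteq> U"
        using U openE by blast
      define s' where "s' = min b (s + d / 2)"
      have s': "s < s'" "s' \<le> b" using s d by (auto simp: s'_def)
      have "integral {s..s'} (\<lambda>\<sigma>. indicator U \<sigma> * G \<sigma>) = integral {s..s'} g"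
      proof (rule integral_cong)
        fix x assume x: "x \<in> {s..s'}"
        then have "x \<in> ball s d" using d by (auto simp: s'_def dist_real_def)
        with x s' s d show "indicator U x * G x = g x" by (auto simp: G_def)
      qed
      then have "dist (\<gamma> s) (\<gamma> s') \<le> integral {s..s'} (\<lambda>\<sigma>. indicator U \<sigma> * G \<sigma>)"
        using gdist[of s s'] set_borel_integral_eq_integral(2)[OF gint[of s s']] s s' \<open>0 \<le> a\<close> by simp
      moreover have "0 \<le> (C + e) * (s' - s)" using \<open>0 \<le> C\<close> \<open>e > 0\<close> s' by simp
      ultimately show ?thesis using mono[OF s'] s' by force
    next
      case False
      then obtain v where v: "v \<le> C" "has_metric_speed \<gamma> v s" using Nspeed s by blast
      have "eventually (\<lambda>r. dist (\<gamma> r) (\<gamma> s) / \<bar>r - s\<bar> < C + e) (at s within {0..})"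
        using v \<open>e > 0\<close> unfolding has_metric_speed_def by (intro order_tendstoD) auto
      then have "eventually (\<lambda>r. dist (\<gamma> r) (\<gamma> s) / \<bar>r - s\<bar> < C + e) (at_right s)"
        by (rule filter_leD[rotated]) (use s \<open>0 \<le> a\<close> in \<open>auto intro!: at_le\<close>)
      then have "eventually (\<lambda>r. dist (\<gamma> r) (\<gamma> s) / \<bar>r - s\<bar> < C + e \<and> r \<in> {s<..<b}) (at_right s)"
        using eventually_at_right_real[OF \<open>s < b\<close>] by (rule eventually_conj)
      then obtain s' where "dist (\<gamma> s') (\<gamma> s) / \<bar>s' - s\<bar> < C + e" and s': "s' \<in> {s<..<b}"
        using eventually_happens'[OF trivial_limit_at_right_real] by blast
      then have "dist (\<gamma> s) (\<gamma> s') \<le> (C + e) * (s' - s)"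
        by (simp add: field_simps dist_commute)
      with mono[of s'] nn[of s'] s' show ?thesis by (intro exI[of _ s']) force
    qed
  qed fact
  moreover have "\<Psi> b \<le> e"
  proof -
    have "\<Psi> b \<le> integral UNIV (\<lambda>\<sigma>. indicator U \<sigma> * G \<sigma>)"
      unfolding \<Psi>_def 
      by (rule integral_subset_le[OF _ UGon integrable_on_lborel[OF UGint]]) (auto simp: G0)
    also have "\<dots> = (LINT s:U|lborel. G s)"
      using integral_lborel[OF UGint] by (simp add: set_lebesgue_integral_def)
    finally show ?thesis using Usmall by simp
  qed
  moreover have "\<Psi> a = 0" by (simp add: \<Psi>_def)
  ultimately have "dist (\<gamma> a) (\<gamma> b) \<le> C * (b - a) + e * (b - a + 1)"
    by (simp add: F_def algebra_simps)
  also have "e * (b - a + 1) = e0" using \<open>a \<le> b\<close> by (simp add: e_def)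
  finally show "dist (\<gamma> a) (\<gamma> b) \<le> C * (b - a) + e0" .
qed

lemma abs_cont_curve_continuous:
  fixes \<gamma> :: "real \<Rightarrow> 'a::metric_space"
  assumes "abs_cont_curve_on UNIV \<gamma>"
  shows "continuous_on UNIV \<gamma>"
proof (rule continuous_at_imp_continuous_on, rule ballI)
  fix s :: real
  have "continuous_on {s - 1..s + 1} \<gamma>"
    by (rule abs_cont_curve_continuous_on[OF assms]) simp
  then show "isCont \<gamma> s"
    by (rule continuous_on_interior) simp
qed

section \<open>The action of an admissible curve\<close>

text \<open>The function \<open>p q - (p - f x)\<close> is affine in \<open>p\<close> with slope \<open>q - 1\<close>.\<close>

lemma lagrangian_eq:
  "lagrangian f x q = (if q \<le> 1 then ereal (f x) else \<infinity>)"
proof (cases "q \<le> 1")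
  case True
  have "p * q - hamiltonian f x p \<le> f x" if "p \<ge> 0" for p
    using mult_left_mono[OF True that] by (simp add: hamiltonian_def)
  moreover have "ereal (f x) \<le> lagrangian f x q"
    unfolding lagrangian_def by (rule SUP_upper2[of 0]) (auto simp: hamiltonian_def)
  ultimately show ?thesis
    using True by (auto simp: lagrangian_def intro!: antisym SUP_least)
next
  case False
  have "lagrangian f x q = \<infinity>"
    unfolding lagrangian_def
  proof (rule SUP_PInfty)
    fix n :: nat
    define p where "p = (real n + \<bar>f x\<bar>) / (q - 1)"
    have "p \<ge> 0" using False by (auto simp: p_def)
    have "p * q - hamiltonian f x p = p * (q - 1) + f x"
      by (simp add: hamiltonian_def algebra_simps)
    also have "\<dots> = real n + \<bar>f x\<bar> + f x"
      using False by (simp add: p_def)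
    finally have "real n \<le> p * q - hamiltonian f x p" by simp
    with \<open>p \<ge> 0\<close> show "\<exists>p\<in>{0..}. ereal (real n) \<le> ereal (p * q - hamiltonian f x p)"
      by (intro bexI[of _ p]) auto
  qed
  with False show ?thesis by simp
qed

lemma ereal_set_integral_continuous:
  fixes h :: "real \<Rightarrow> real"
  assumes "continuous_on {a..b} h"
  shows "ereal_set_integral {a..b} (\<lambda>\<sigma>. ereal (h \<sigma>)) = ereal (integral {a..b} h)"
proof -
  have si: "set_integrable lborel {a..b} h"
    using borel_integrable_compact[OF compact_Icc assms]
    by (simp add: set_integrable_def indicator_def mult.commute cong: if_cong)
  then have int: "integrable lborel (\<lambda>\<sigma>. indicator {a..b} \<sigma> * h \<sigma>)"
    by (simp add: set_integrable_def)
  have pos: "(\<integral>\<^sup>+\<sigma>\<in>{a..b}. e2ennreal (ereal (h \<sigma>)) \<partial>lborel) = (\<integral>\<^sup>+\<sigma>. ennreal (indicator {a..b} \<sigma> * h \<sigma>) \<partial>lborel)"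
    by (intro nn_integral_cong) (auto simp: indicator_def zero_ereal_def)
  have neg: "(\<integral>\<^sup>+\<sigma>\<in>{a..b}. e2ennreal (- ereal (h \<sigma>)) \<partial>lborel) = (\<integral>\<^sup>+\<sigma>. ennreal (- (indicator {a..b} \<sigma> * h \<sigma>)) \<partial>lborel)"
    by (intro nn_integral_cong) (auto simp: indicator_def zero_ereal_def)
  have fin: "enn2ereal x = ereal (enn2real x)" if "x \<noteq> \<infinity>" for x
    using that by (cases x) (auto simp: enn2ereal_ennreal)
  show ?thesis
    using int set_borel_integral_eq_integral(2)[OF si] real_lebesgue_integral_def[OF int]
    unfolding ereal_set_integral_def pos neg
    by (simp add: fin real_integrable_def set_lebesgue_integral_def)
qed

lemma ereal_set_integral_cong_AE:
  assumes "AE \<sigma> in lborel. \<sigma> \<in> A \<longrightarrow> h \<sigma> = k \<sigma>"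
  shows "ereal_set_integral A h = ereal_set_integral A k"
proof -
  have "(\<integral>\<^sup>+\<sigma>\<in>A. e2ennreal (h \<sigma>) \<partial>lborel) = (\<integral>\<^sup>+\<sigma>\<in>A. e2ennreal (k \<sigma>) \<partial>lborel)"
    "(\<integral>\<^sup>+\<sigma>\<in>A. e2ennreal (- h \<sigma>) \<partial>lborel) = (\<integral>\<^sup>+\<sigma>\<in>A. e2ennreal (- k \<sigma>) \<partial>lborel)"
    using assms by (auto intro!: nn_integral_cong_AE simp: indicator_def elim!: eventually_mono)
  then show ?thesis by (simp add: ereal_set_integral_def)
qed

lemma AE_lborel_neq: "AE \<sigma> in lborel. \<sigma> \<noteq> (c::real)"
  by (rule AE_I[where N="{c}"]) auto

lemma action_eq_integral:
  assumes f: "continuous_on UNIV f" and \<gamma>: "continuous_on {0..\<delta>} \<gamma>"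
    and speed: "AE \<sigma> in lborel. 0 \<le> \<sigma> \<and> \<sigma> < \<delta> \<longrightarrow> (\<exists>v\<le>1. has_metric_speed \<gamma> v \<sigma>)"
  shows "action f \<gamma> \<delta> = ereal (integral {0..\<delta>} (\<lambda>\<sigma>. f (\<gamma> \<sigma>)))"
proof -
  have "continuous_on {0..\<delta>} (\<lambda>\<sigma>. f (\<gamma> \<sigma>))"
    by (rule continuous_on_compose2[OF f \<gamma>]) auto
  moreover have "AE \<sigma> in lborel. \<sigma> \<in> {0..\<delta>} \<longrightarrow>
      lagrangian f (\<gamma> \<sigma>) (metric_speed \<gamma> \<sigma>) = ereal (f (\<gamma> \<sigma>))"
    using speed AE_lborel_neq[of \<delta>]
  proof eventually_elim
    case (elim \<sigma>)
    show ?case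
    proof
      assume "\<sigma> \<in> {0..\<delta>}"
      with elim obtain v where "v \<le> 1" "has_metric_speed \<gamma> v \<sigma>" by force
      with \<open>\<sigma> \<in> {0..\<delta>}\<close> show "lagrangian f (\<gamma> \<sigma>) (metric_speed \<gamma> \<sigma>) = ereal (f (\<gamma> \<sigma>))"
        by (simp add: metric_speed_eq lagrangian_eq)
    qed
  qed
  ultimately show ?thesis
    unfolding action_def
    by (simp add: ereal_set_integral_cong_AE ereal_set_integral_continuous)
qed

text \<open>The positive part of the Lagrangian has infinite integral, while the negative part is bounded by \<open>M\<close>,
so no indeterminate difference arises.\<close>

lemma action_infinite:
  assumes M: "\<And>x. \<bar>f x\<bar> \<le> M" and ab: "0 \<le> a" "a < b" "b \<le> \<delta>" and "v > 1"
    and speed: "AE \<sigma> in lborel. a \<le> \<sigma> \<and> \<sigma> \<le> b \<longrightarrow> has_metric_speed \<gamma> v \<sigma>"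
  shows "action f \<gamma> \<delta> = \<infinity>"
proof -
  let ?L = "\<lambda>\<sigma>. lagrangian f (\<gamma> \<sigma>) (metric_speed \<gamma> \<sigma>)"
  have "(\<integral>\<^sup>+\<sigma>\<in>{0..\<delta>}. e2ennreal (?L \<sigma>) \<partial>lborel) \<ge> (\<integral>\<^sup>+\<sigma>. \<infinity> * indicator {a..b} \<sigma> \<partial>lborel)"
  proof (rule nn_integral_mono_AE)
    show "AE \<sigma> in lborel. \<infinity> * indicator {a..b} \<sigma> \<le> e2ennreal (?L \<sigma>) * indicator {0..\<delta>} \<sigma>"
      using speed
    proof eventually_elim
      case (elim \<sigma>)
      show ?case
      proof (cases "\<sigma> \<in> {a..b}")
        case True
        with elim ab have "metric_speed \<gamma> \<sigma> = v" by (auto intro: metric_speed_eq)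
        with True ab \<open>v > 1\<close> show ?thesis by (simp add: lagrangian_eq)
      qed simp
    qed
  qed
  moreover have "(\<integral>\<^sup>+\<sigma>. \<infinity> * indicator {a..b} \<sigma> \<partial>lborel) = (\<infinity>::ennreal)"
    using ab by (subst nn_integral_cmult_indicator) (auto simp: ennreal_top_mult)
  ultimately have pos: "(\<integral>\<^sup>+\<sigma>\<in>{0..\<delta>}. e2ennreal (?L \<sigma>) \<partial>lborel) = \<infinity>"
    by (simp add: top_unique)
  have "(\<integral>\<^sup>+\<sigma>\<in>{0..\<delta>}. e2ennreal (- ?L \<sigma>) \<partial>lborel) \<le> (\<integral>\<^sup>+\<sigma>\<in>{0..\<delta>}. ennreal M \<partial>lborel)"
  proof (rule nn_integral_mono)
    fix \<sigma>
    have "- ?L \<sigma> \<le> ereal M" using M[of "\<gamma> \<sigma>"] by (auto simp: lagrangian_eq)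
    then show "e2ennreal (- ?L \<sigma>) * indicator {0..\<delta>} \<sigma> \<le> ennreal M * indicator {0..\<delta>} \<sigma>"
      using e2ennreal_mono[of "- ?L \<sigma>" "ereal M"] by (simp add: mult_right_mono)
  qed
  also have "\<dots> < \<infinity>"
    using ab by (subst nn_integral_cmult_indicator) (auto simp: ennreal_mult_less_top)
  finally have "enn2ereal (\<integral>\<^sup>+\<sigma>\<in>{0..\<delta>}. e2ennreal (- ?L \<sigma>) \<partial>lborel) \<noteq> \<infinity>"
    by (cases "\<integral>\<^sup>+\<sigma>\<in>{0..\<delta>}. e2ennreal (- ?L \<sigma>) \<partial>lborel") (auto simp: enn2ereal_ennreal)
  with pos show ?thesis
    unfolding action_def ereal_set_integral_def by simp
qed

lemma admissible_curve_pieces: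
  assumes "\<gamma> \<in> admissible_curves f x"
  obtains n :: nat and r v where "r 0 = 0" "\<And>i. i < n \<Longrightarrow> r i < r (Suc i)"
    "AE \<sigma> in lborel. \<forall>i\<le>n. r i \<le> \<sigma> \<and> (i < n \<longrightarrow> \<sigma> \<le> r (Suc i)) \<longrightarrow> has_metric_speed \<gamma> (v i) \<sigma>"
proof -
  obtain n r where nr: "r 0 = 0" "\<forall>i<n. r i < r (Suc i)"
    and ok: "\<forall>i<n. piece_ok f \<gamma> {r i..r (Suc i)}" "piece_ok f \<gamma> {r n..}"
    using assms unfolding admissible_curves_def by blast
  have "\<exists>v. AE \<sigma> in lborel. r i \<le> \<sigma> \<and> (i < n \<longrightarrow> \<sigma> \<le> r (Suc i)) \<longrightarrow> has_metric_speed \<gamma> v \<sigma>"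
    if "i \<le> n" for i
  proof (cases "i < n")
    case True
    with ok(1) show ?thesis unfolding piece_ok_def by (auto simp: Ball_def)
  next
    case False
    with that ok(2) show ?thesis unfolding piece_ok_def by auto
  qed
  then obtain v where "AE \<sigma> in lborel. r i \<le> \<sigma> \<and> (i < n \<longrightarrow> \<sigma> \<le> r (Suc i)) \<longrightarrow> has_metric_speed \<gamma> (v i) \<sigma>"
    if "i \<le> n" for i by metis
  then have "AE \<sigma> in lborel. \<forall>i\<in>{..n}. r i \<le> \<sigma> \<and> (i < n \<longrightarrow> \<sigma> \<le> r (Suc i)) \<longrightarrow> has_metric_speed \<gamma> (v i) \<sigma>"
    by (intro AE_finite_allI) auto
  with nr show ?thesis by (intro that[of r n v]) auto
qed

lemma breakpoints_cover:
  fixes r :: "nat \<Rightarrow> real"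
  assumes "r 0 \<le> \<sigma>"
  shows "\<exists>i\<le>n. r i \<le> \<sigma> \<and> (i < n \<longrightarrow> \<sigma> \<le> r (Suc i))"
proof (induction n)
  case 0 with assms show ?case by auto
next
  case (Suc n)
  then obtain i where i: "i \<le> n" "r i \<le> \<sigma>" "i < n \<longrightarrow> \<sigma> \<le> r (Suc i)" by blast
  show ?case
  proof (cases "i = n \<and> r (Suc n) < \<sigma>")
    case True then show ?thesis by (intro exI[of _ "Suc n"]) auto
  next
    case False with i show ?thesis by (intro exI[of _ i]) auto
  qed
qed

lemma admissible_curve_speed_exists:
  assumes "\<gamma> \<in> admissible_curves f x"
  shows "AE \<sigma> in lborel. 0 \<le> \<sigma> \<longrightarrow> (\<exists>v. has_metric_speed \<gamma> v \<sigma>)"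
proof -
  obtain n :: nat and r v where r: "r 0 = 0" "\<And>i. i < n \<Longrightarrow> r i < r (Suc i)"
    and ae: "AE \<sigma> in lborel. \<forall>i\<le>n. r i \<le> \<sigma> \<and> (i < n \<longrightarrow> \<sigma> \<le> r (Suc i)) \<longrightarrow> has_metric_speed \<gamma> (v i) \<sigma>"
    by (rule admissible_curve_pieces[OF assms], rule that)
  from ae show ?thesis
  proof eventually_elim
    case (elim \<sigma>)
    with breakpoints_cover[of r \<sigma> n] r show ?case by auto
  qed
qed

lemma action_lipschitz_curve:
  assumes f: "continuous_on UNIV f" and \<gamma>: "\<gamma> \<in> admissible_curves f x"
    and lip: "1-lipschitz_on {0..\<delta>} \<gamma>"
  shows "action f \<gamma> \<delta> = ereal (integral {0..\<delta>} (\<lambda>\<sigma>. f (\<gamma> \<sigma>)))"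
proof (rule action_eq_integral[OF f lipschitz_on_continuous_on[OF lip]])
  show "AE \<sigma> in lborel. 0 \<le> \<sigma> \<and> \<sigma> < \<delta> \<longrightarrow> (\<exists>v\<le>1. has_metric_speed \<gamma> v \<sigma>)"
    using admissible_curve_speed_exists[OF \<gamma>]
  proof eventually_elim
    case (elim \<sigma>)
    show ?case
    proof
      assume \<sigma>: "0 \<le> \<sigma> \<and> \<sigma> < \<delta>"
      with elim obtain v where "has_metric_speed \<gamma> v \<sigma>" by auto
      with metric_speed_le_lipschitz[OF this _ _ lip] \<sigma> show "\<exists>v\<le>1. has_metric_speed \<gamma> v \<sigma>"
        by auto
    qed
  qed
qed

text \<open>The speed is constant on each piece. If a piece that starts before \<open>\<delta>\<close> had speed above one, the
Lagrangian would be infinite on a set of positive measure. So the speed is at most one almost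
everywhere up to \<open>\<delta>\<close>.\<close>

lemma finite_action_imp_lipschitz:
  assumes f: "continuous_on UNIV f" and M: "\<And>x. \<bar>f x\<bar> \<le> M" and \<gamma>: "\<gamma> \<in> admissible_curves f x"
    and "action f \<gamma> \<delta> \<noteq> \<infinity>"
  shows "1-lipschitz_on {0..\<delta>} \<gamma>"
proof -
  have ac: "abs_cont_curve_on {0..} \<gamma>" using \<gamma> by (simp add: admissible_curves_def)
  obtain n :: nat and r v where r: "r 0 = 0" "\<And>i. i < n \<Longrightarrow> r i < r (Suc i)"
    and ae: "AE \<sigma> in lborel. \<forall>i\<le>n. r i \<le> \<sigma> \<and> (i < n \<longrightarrow> \<sigma> \<le> r (Suc i)) \<longrightarrow> has_metric_speed \<gamma> (v i) \<sigma>"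
    by (rule admissible_curve_pieces[OF \<gamma>], rule that)
  have r0: "0 \<le> r i" if "i \<le> n" for i
    using that
  proof (induction i)
    case (Suc i) then show ?case using r(2)[of i] by simp
  qed (use r in simp)
  have slow: "v i \<le> 1" if "i \<le> n" "r i < \<delta>" for i
  proof (rule ccontr)
    assume fast: "\<not> v i \<le> 1"
    define b where "b = (if i < n then min \<delta> (r (Suc i)) else \<delta>)"
    have "AE \<sigma> in lborel. r i \<le> \<sigma> \<and> \<sigma> \<le> b \<longrightarrow> has_metric_speed \<gamma> (v i) \<sigma>"
      using ae by eventually_elim (use that in \<open>auto simp: b_def split: if_splits\<close>)
    then have "action f \<gamma> \<delta> = \<infinity>"
      by (rule action_infinite[OF M, rotated -1])
         (use fast that r(2)[of i] r0[of i] in \<open>auto simp: b_def\<close>)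
    with assms show False by simp
  qed
  have speed: "AE \<sigma> in lborel. 0 \<le> \<sigma> \<and> \<sigma> < \<delta> \<longrightarrow> (\<exists>v\<le>1. has_metric_speed \<gamma> v \<sigma>)"
    using ae
  proof eventually_elim
    case (elim \<sigma>)
    show ?case
    proof
      assume \<sigma>: "0 \<le> \<sigma> \<and> \<sigma> < \<delta>"
      then obtain i where i: "i \<le> n" "r i \<le> \<sigma>" "i < n \<longrightarrow> \<sigma> \<le> r (Suc i)"
        using breakpoints_cover[of r \<sigma> n] r by auto
      with \<sigma> elim slow[of i] show "\<exists>v\<le>1. has_metric_speed \<gamma> v \<sigma>" by force
    qed
  qed
  show ?thesis
  proof (rule lipschitz_on_leI)
    fix a b assume ab: "a \<in> {0..\<delta>}" "b \<in> {0..\<delta>}" "a \<le> b"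
    have "AE \<sigma> in lborel. a \<le> \<sigma> \<and> \<sigma> < b \<longrightarrow> (\<exists>v\<le>1. has_metric_speed \<gamma> v \<sigma>)"
      using speed by eventually_elim (use ab in auto)
    with abs_cont_curve_lipschitz[OF ac, of a b 1] ab
    show "dist (\<gamma> a) (\<gamma> b) \<le> 1 * dist a b"
      by (auto simp: dist_real_def)
  qed simp
qed

section \<open>Arclength parametrization\<close>

text \<open>The length of the polygon inscribed in a curve at the given parameters; recursion on the list suits
the insertion of partition points better than indices do.\<close>

fun chord_sum :: "(real \<Rightarrow> 'a::metric_space) \<Rightarrow> real list \<Rightarrow> real" where
  "chord_sum g [] = 0"
| "chord_sum g [a] = 0"
| "chord_sum g (a # b # ts) = dist (g a) (g b) + chord_sum g (b # ts)"

lemma chord_sum_eq_sum: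
  "chord_sum g ts = (\<Sum>i<length ts - 1. dist (g (ts ! i)) (g (ts ! Suc i)))"
  by (induction g ts rule: chord_sum.induct) (simp_all add: sum.lessThan_Suc_shift del: sum.lessThan_Suc)

lemma chord_sum_append:
  "chord_sum g (xs @ c # ys) = chord_sum g (xs @ [c]) + chord_sum g (c # ys)"
  by (induction g xs rule: chord_sum.induct) auto

lemma chord_sum_insert: "chord_sum g (xs @ ys) \<le> chord_sum g (xs @ c # ys)"
proof (induction g xs rule: chord_sum.induct)
  case (1 g) then show ?case by (cases ys) auto
next
  case (2 g a)
  show ?case
  proof (cases ys)
    case (Cons b zs) then show ?thesis using dist_triangle[of "g a" "g b" "g c"] by simp
  qed simp
qed simp

lemma chord_sum_const: "(\<And>s. s \<in> set ts \<Longrightarrow> g s = x) \<Longrightarrow> chord_sum g ts = 0"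
  by (induction g ts rule: chord_sum.induct) auto

lemma chord_sum_cong: "(\<And>s. s \<in> set ts \<Longrightarrow> g s = h (k s)) \<Longrightarrow> chord_sum g ts = chord_sum h (map k ts)"
  by (induction g ts rule: chord_sum.induct) auto

text \<open>The arclength \<open>V t\<close> of the curve up to \<open>t\<close> is the supremum of the chord sums of partitions of
\<open>{0..t}\<close>. Its continuity is the point: for a partition whose chord sum is within \<open>\<eta>\<close> of the full
length, the arclength of any interval without partition points exceeds the chord of that interval by
at most \<open>\<eta>\<close>, since otherwise inserting the endpoints would give a chord sum above the full length.\<close>

lemma arclength_function:
  fixes g :: "real \<Rightarrow> 'a::metric_space"
  assumes g: "continuous_on {0..1} g" and fin: "curve_length g < \<infinity>"
  obtains V where "V 0 = 0" "continuous_on {0..1} V" "ereal (V 1) = curve_length g"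
    "\<And>s t. 0 \<le> s \<Longrightarrow> s \<le> t \<Longrightarrow> t \<le> 1 \<Longrightarrow> dist (g s) (g t) \<le> V t - V s"
    "\<And>\<eta>. \<eta> > 0 \<Longrightarrow> \<exists>ts. sorted ts \<and> set ts \<subseteq> {0..1} \<and> V 1 - \<eta> < chord_sum g ts"
proof -
  define A where "A t = {ts. sorted ts \<and> set ts \<subseteq> {0..t}}" for t :: real
  have CL: "curve_length g = (SUP ts\<in>A 1. ereal (chord_sum g ts))"
    by (simp add: curve_length_def A_def chord_sum_eq_sum)
  have Nil: "[] \<in> A t" for t by (simp add: A_def)
  have "0 \<le> curve_length g"
    unfolding CL by (rule SUP_upper2[OF Nil]) simp
  with fin obtain l where l: "curve_length g = ereal l" by (cases "curve_length g") auto
  have le_l: "chord_sum g ts \<le> l" if "ts \<in> A 1" for ts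
    using SUP_upper[OF that, of "\<lambda>ts. ereal (chord_sum g ts)"] by (simp add: CL[symmetric] l)
  have A_mono: "A s \<subseteq> A t" if "s \<le> t" for s t
    using that by (force simp: A_def)
  define V where "V t = (SUP ts\<in>A t. chord_sum g ts)" for t
  have bdd: "bdd_above (chord_sum g ` A t)" if "t \<le> 1" for t
    using le_l A_mono[OF that] by (intro bdd_aboveI[of _ l]) auto
  have upper: "chord_sum g ts \<le> V t" if "ts \<in> A t" "t \<le> 1" for ts t
    unfolding V_def by (rule cSUP_upper[OF that(1) bdd[OF that(2)]])
  have least: "V t \<le> z" if "\<And>ts. ts \<in> A t \<Longrightarrow> chord_sum g ts \<le> z" for t z
    unfolding V_def using Nil that by (intro cSUP_least) auto
  have add: "V t + chord_sum g (t # ys) \<le> V u"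
    if "0 \<le> t" "t \<le> u" "u \<le> 1" "sorted (t # ys)" "set ys \<subseteq> {t..u}" for t u ys
  proof -
    have "V t \<le> V u - chord_sum g (t # ys)"
    proof (rule least)
      fix us assume us: "us \<in> A t"
      have "us @ t # ys \<in> A u"
        using us that unfolding A_def by (force simp: sorted_append)
      from upper[OF this] that(3)
      have "chord_sum g (us @ [t]) + chord_sum g (t # ys) \<le> V u"
        using chord_sum_append[of g us t ys] by simp
      with chord_sum_insert[of g us "[]" t]
      show "chord_sum g us \<le> V u - chord_sum g (t # ys)" by simp
    qed
    then show ?thesis by simp
  qed
  have V_dist: "dist (g s) (g t) \<le> V t - V s" if "0 \<le> s" "s \<le> t" "t \<le> 1" for s t
    using add[of s t "[t]"] that by simp
  have V_mono: "V s \<le> V t" if "0 \<le> s" "s \<le> t" "t \<le> 1" for s t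
    using V_dist[OF that] zero_le_dist[of "g s" "g t"] by linarith
  have approx: "\<exists>ts\<in>A 1. V 1 - \<eta> < chord_sum g ts" if "\<eta> > 0" for \<eta>
    using less_cSUP_iff[of "A 1" "chord_sum g" "V 1 - \<eta>"] bdd[of 1] Nil that
    by (auto simp: V_def)
  \<comment> \<open>Off the points of a nearly optimal partition, the length is nearly the chord.\<close>
  have gap: "V t - V s \<le> dist (g s) (g t) + \<eta>"
    if ts: "ts \<in> A 1" "V 1 - \<eta> < chord_sum g ts" and st: "0 \<le> s" "s < t" "t \<le> 1"
      and free: "set ts \<inter> {s<..<t} = {}" for s t \<eta> ts
  proof -
    define xs ys where "xs = takeWhile (\<lambda>z. z \<le> s) ts" and "ys = dropWhile (\<lambda>z. z \<le> s) ts"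
    have ts_eq: "ts = xs @ ys" by (simp add: xs_def ys_def)
    have xs: "set xs \<subseteq> {..s}" by (auto simp: xs_def dest: set_takeWhileD)
    have sorted: "sorted xs" "sorted ys" and sub: "set xs \<subseteq> {0..}" "set ys \<subseteq> {..1}"
      using ts(1) unfolding A_def ts_eq by (auto simp: sorted_append)
    have "s < z" if "z \<in> set ys" for z
    proof -
      from that obtain y ys' where y: "ys = y # ys'" by (cases ys) auto
      then have "\<not> y \<le> s" using hd_dropWhile[of "\<lambda>z. z \<le> s" ts] by (auto simp: ys_def)
      with y sorted(2) that show ?thesis by auto
    qed
    then have ys: "set ys \<subseteq> {t..1}" using free sub(2) by (force simp: ts_eq)
    have "xs @ [s] \<in> A s"
      using xs sorted(1) sub(1) st by (force simp: A_def sorted_append)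
    then have "chord_sum g (xs @ [s]) \<le> V s" using st by (intro upper) auto
    moreover have "V t + chord_sum g (t # ys) \<le> V 1"
      using ys sorted(2) st by (intro add) auto
    moreover have "chord_sum g (xs @ ys) \<le> chord_sum g (xs @ [s]) + dist (g s) (g t) + chord_sum g (t # ys)"
      using chord_sum_insert[of g xs ys t] chord_sum_insert[of g xs "t # ys" s]
        chord_sum_append[of g xs s "t # ys"] by simp
    ultimately show ?thesis using ts(2) by (simp add: ts_eq)
  qed
  have cont: "continuous_on {0..1} V"
    unfolding continuous_on_iff
  proof (intro ballI allI impI)
    fix x \<epsilon> :: real assume x: "x \<in> {0..1}" and "\<epsilon> > 0"
    obtain ts where ts: "ts \<in> A 1" "V 1 - \<epsilon> / 2 < chord_sum g ts"
      using approx[of "\<epsilon> / 2"] \<open>\<epsilon> > 0\<close> by auto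
    \<comment> \<open>Within \<open>d1\<close> of \<open>x\<close> the partition has no point except possibly \<open>x\<close> itself.\<close>
    obtain d1 where d1: "d1 > 0" "\<forall>z\<in>set ts. z \<noteq> x \<longrightarrow> d1 \<le> dist x z"
      using finite_set_avoid[of "set ts" x] by auto
    obtain d2 where d2: "d2 > 0" "\<And>x'. x' \<in> {0..1} \<Longrightarrow> dist x' x < d2 \<Longrightarrow> dist (g x') (g x) < \<epsilon> / 2"
      using g x \<open>\<epsilon> > 0\<close> unfolding continuous_on_iff by (metis half_gt_zero)
    show "\<exists>d>0. \<forall>x'\<in>{0..1}. dist x' x < d \<longrightarrow> dist (V x') (V x) < \<epsilon>"
    proof (intro exI[of _ "min d1 d2"] conjI ballI impI)
      fix x' assume x': "x' \<in> {0..1}" "dist x' x < min d1 d2"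
      have free: "set ts \<inter> {min x x'<..<max x x'} = {}"
        using d1(2) x'(2) by (force simp: dist_real_def)
      have "\<bar>V x' - V x\<bar> \<le> dist (g x') (g x) + \<epsilon> / 2"
      proof (cases x x' rule: linorder_cases)
        case less
        with gap[OF ts, of x x'] free V_mono[of x x'] x x' show ?thesis
          by (simp add: dist_commute[of "g x'" "g x"])
      next
        case greater
        with gap[OF ts, of x' x] free V_mono[of x' x] x x' show ?thesis
          by simp
      qed (use \<open>\<epsilon> > 0\<close> in simp)
      also have "\<dots> < \<epsilon>" using d2(2)[of x'] x' by simp
      finally show "dist (V x') (V x) < \<epsilon>" by (simp add: dist_real_def)
    qed (use d1 d2 in simp)
  qed
  have "V 0 = 0"
  proof (rule antisym)
    show "V 0 \<le> 0"
    proof (rule least)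
      fix ts assume "ts \<in> A 0"
      then show "chord_sum g ts \<le> 0"
        using chord_sum_const[of ts g "g 0"] by (force simp: A_def)
    qed
    show "0 \<le> V 0" using upper[OF Nil, of 0] by simp
  qed
  moreover have "ereal (V 1) = curve_length g"
  proof (rule antisym)
    show "ereal (V 1) \<le> curve_length g" using least[OF le_l] l by simp
    show "curve_length g \<le> ereal (V 1)"
      unfolding CL by (rule SUP_least) (use upper in auto)
  qed
  ultimately show ?thesis
    using cont V_dist approx by (intro that[of V]) (auto simp: A_def)
qed

text \<open>The map that sends arclength to the point of the path is well defined, because arclength dominates
distance, and it is defined on a full interval, because arclength is continuous. The last
conclusion says that \<open>c\<close> has length \<open>v (b - a)\<close>, the largest one that a \<open>v\<close>-Lipschitz curve can have.\<close>

lemma proportional_arclength_curve: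
  fixes x y :: "'a::metric_space"
  assumes ls: "length_space TYPE('a)" and ab: "a < b" and xy: "dist x y < b - a"
  obtains c v where "0 \<le> v" "v \<le> 1" "v-lipschitz_on {a..b} c" "c a = x" "c b = y"
    "\<And>\<eta>. \<eta> > 0 \<Longrightarrow> \<exists>ts. sorted ts \<and> set ts \<subseteq> {a..b} \<and> v * (b - a) - \<eta> < chord_sum c ts"
proof -
  have "(INF g \<in> {g. path g \<and> pathstart g = x \<and> pathfinish g = y}. curve_length g) < ereal (b - a)"
    using ls xy unfolding length_space_def by (metis less_ereal.simps(1))
  then obtain g where "path g" and g0: "g 0 = x" and g1: "g 1 = y" and len: "curve_length g < ereal (b - a)"
    by (auto simp: INF_less_iff pathstart_def pathfinish_def)
  then have "continuous_on {0..1} g" "curve_length g < \<infinity>" by (auto simp: path_def less_trans)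
  then obtain V where V0: "V 0 = 0" and Vcont: "continuous_on {0..1} V" and V1: "ereal (V 1) = curve_length g"
    and Vdist: "\<And>s t. 0 \<le> s \<Longrightarrow> s \<le> t \<Longrightarrow> t \<le> 1 \<Longrightarrow> dist (g s) (g t) \<le> V t - V s"
    and Vapprox: "\<And>\<eta>. \<eta> > 0 \<Longrightarrow> \<exists>ts. sorted ts \<and> set ts \<subseteq> {0..1} \<and> V 1 - \<eta> < chord_sum g ts"
    using arclength_function by blast
  have Vmono: "V s \<le> V t" if "0 \<le> s" "s \<le> t" "t \<le> 1" for s t
    using Vdist[OF that] zero_le_dist[of "g s" "g t"] by linarith
  have Vabs: "dist (g s) (g t) \<le> \<bar>V s - V t\<bar>" if "s \<in> {0..1}" "t \<in> {0..1}" for s t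
    using Vdist[of s t] Vdist[of t s] that by (cases "s \<le> t") (auto simp: dist_commute)
  define v where "v = V 1 / (b - a)"
  have v: "0 \<le> v" "v \<le> 1"
  proof -
    have "V 1 < b - a" using len by (simp flip: V1)
    then show "0 \<le> v" "v \<le> 1" using ab Vmono[of 0 1] V0 by (auto simp: v_def)
  qed
  \<comment> \<open>Several parameters may have the same arclength, but the path takes the same value at them.\<close>
  define \<theta> where "\<theta> \<tau> = (SOME t. t \<in> {0..1} \<and> V t = v * (\<tau> - a))" for \<tau>
  have \<theta>: "\<theta> \<tau> \<in> {0..1} \<and> V (\<theta> \<tau>) = v * (\<tau> - a)" if "\<tau> \<in> {a..b}" for \<tau>
  proof -
    have "v * (\<tau> - a) \<le> v * (b - a)" using that v by (intro mult_left_mono) auto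
    moreover have "0 \<le> v * (\<tau> - a)" using that v by simp
    ultimately have "V 0 \<le> v * (\<tau> - a)" "v * (\<tau> - a) \<le> V 1"
      using V0 ab by (auto simp: v_def)
    then have "\<exists>t. t \<in> {0..1} \<and> V t = v * (\<tau> - a)"
      using IVT'[of V 0 "v * (\<tau> - a)" 1] Vcont by auto
    then show ?thesis unfolding \<theta>_def by (rule someI_ex)
  qed
  define c where "c \<tau> = g (\<theta> \<tau>)" for \<tau>
  have eq: "c \<tau> = g t" if "\<tau> \<in> {a..b}" "t \<in> {0..1}" "V t = v * (\<tau> - a)" for \<tau> t
    using Vabs[of "\<theta> \<tau>" t] \<theta>[of \<tau>] that by (simp add: c_def)
  show ?thesis
  proof (rule that[OF v])
    show "v-lipschitz_on {a..b} c"
    proof (rule lipschitz_onI)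
      fix s t assume "s \<in> {a..b}" "t \<in> {a..b}"
      then have "dist (c s) (c t) \<le> \<bar>v * (s - a) - v * (t - a)\<bar>"
        using Vabs[of "\<theta> s" "\<theta> t"] \<theta>[of s] \<theta>[of t] by (simp add: c_def)
      also have "\<dots> = v * dist s t"
        using v by (simp add: dist_real_def abs_mult flip: right_diff_distrib)
      finally show "dist (c s) (c t) \<le> v * dist s t" .
    qed (use v in simp)
    show "c a = x" using eq[of a 0] V0 g0 ab by simp
    show "c b = y" using eq[of b 1] g1 ab by (simp add: v_def)
    fix \<eta> :: real assume "\<eta> > 0"
    then obtain ts where ts: "sorted ts" "set ts \<subseteq> {0..1}" "V 1 - \<eta> < chord_sum g ts"
      using Vapprox by blast
    show "\<exists>ts. sorted ts \<and> set ts \<subseteq> {a..b} \<and> v * (b - a) - \<eta> < chord_sum c ts"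
    proof (cases "V 1 = 0")
      case True
      then show ?thesis using \<open>\<eta> > 0\<close> by (intro exI[of _ "[]"]) (simp add: v_def)
    next
      case False
      then have "v > 0" using v ab by (auto simp: v_def less_le)
      define k where "k t = a + V t / v" for t
      have kt: "k t \<in> {a..b}" "V t = v * (k t - a)" if "t \<in> {0..1}" for t
      proof -
        have "0 \<le> V t / v" "V t / v \<le> V 1 / v"
          using Vmono[of 0 t] Vmono[of t 1] that V0 \<open>v > 0\<close> by (auto intro: divide_right_mono)
        moreover have "V 1 / v = b - a" using False by (simp add: v_def)
        ultimately show "k t \<in> {a..b}" "V t = v * (k t - a)"
          using \<open>v > 0\<close> by (auto simp: k_def)
      qed
      have "sorted (map k ts)"
      proof -
        have "mono_on {0..1} k"
          using Vmono \<open>v > 0\<close> by (auto simp: mono_on_def k_def divide_right_mono)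
        with ts(1,2) show ?thesis
          by (auto simp: sorted_map intro!: sorted_wrt_mono_rel[of ts "(\<le>)"] dest: mono_onD)
      qed
      moreover have "chord_sum g ts = chord_sum c (map k ts)"
        using ts(2) eq kt by (intro chord_sum_cong) force
      moreover have "V 1 = v * (b - a)" using ab by (simp add: v_def)
      ultimately show ?thesis
        using ts kt(1) by (intro exI[of _ "map k ts"]) (auto simp: image_subset_iff subset_iff)
    qed
  qed
qed

section \<open>The metric speed of an arclength parametrization\<close>

text \<open>The defect \<open>v (b - a) - dist (c a) (c b)\<close> measures how much a \<open>v\<close>-Lipschitz curve wastes on an
interval. It is nonnegative and, by the triangle inequality, superadditive over disjoint intervals.\<close>

lemma sum_defect_le:
  fixes c :: "real \<Rightarrow> 'a::metric_space"
  assumes lip: "v-lipschitz_on {a..b} c" and "finite F"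
    and F: "\<And>l r. (l, r) \<in> F \<Longrightarrow> a \<le> l \<and> l < r \<and> r \<le> b"
    and disj: "pairwise (\<lambda>i j. disjnt {fst i..snd i} {fst j..snd j}) F" and "a \<le> b"
  shows "(\<Sum>(l, r)\<in>F. v * (r - l) - dist (c l) (c r)) \<le> v * (b - a) - dist (c a) (c b)"
  using assms
proof (induction "card F" arbitrary: F b)
  case 0
  then have "F = {}" by simp
  moreover have "dist (c a) (c b) \<le> v * dist a b"
    using 0 by (intro lipschitz_onD[of v "{a..b}"]) auto
  ultimately show ?case using 0 by (simp add: dist_real_def)
next
  case (Suc n)
  note lip = Suc.prems(1) and fin = Suc.prems(2) and F = Suc.prems(3)
    and disj = Suc.prems(4) and card = Suc.hyps(2)
  have "F \<noteq> {}" using card by auto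
  \<comment> \<open>Split off the last interval.\<close>
  then have "Max (fst ` F) \<in> fst ` F" using fin by (intro Max_in) auto
  then obtain l r where lr: "(l, r) \<in> F" and l_max: "l = Max (fst ` F)" by force
  have l: "a \<le> l" "l < r" "r \<le> b" using F[OF lr] by auto
  have left: "r' \<le> l" if lr': "(l', r') \<in> F - {(l, r)}" for l' r'
  proof -
    have "l' \<in> fst ` F" using lr' by (intro rev_image_eqI[of "(l', r')"]) auto
    then have "l' \<le> l" unfolding l_max using fin by (intro Max_ge) auto
    moreover have "disjnt {l'..r'} {l..r}"
      using pairwiseD[OF disj, of "(l', r')" "(l, r)"] lr' lr by auto
    then have "l \<notin> {l'..r'}" using l by (auto simp: disjnt_def)
    ultimately show ?thesis by auto
  qed
  have "(\<Sum>(l, r)\<in>F - {(l, r)}. v * (r - l) - dist (c l) (c r)) \<le> v * (l - a) - dist (c a) (c l)"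
  proof (rule Suc.hyps(1))
    show "n = card (F - {(l, r)})" using card fin lr by simp
    show "v-lipschitz_on {a..l} c" by (rule lipschitz_on_subset[OF lip]) (use l in auto)
    show "pairwise (\<lambda>i j. disjnt {fst i..snd i} {fst j..snd j}) (F - {(l, r)})"
      using disj by (rule pairwise_subset) auto
    show "a \<le> l' \<and> l' < r' \<and> r' \<le> l" if "(l', r') \<in> F - {(l, r)}" for l' r'
      using F[of l' r'] left[OF that] that by auto
  qed (use fin l in auto)
  moreover have "(\<Sum>(l, r)\<in>F. v * (r - l) - dist (c l) (c r)) =
      v * (r - l) - dist (c l) (c r) + (\<Sum>(l, r)\<in>F - {(l, r)}. v * (r - l) - dist (c l) (c r))"
    by (subst sum.remove[OF fin lr]) simp
  moreover have "dist (c a) (c b) \<le> dist (c a) (c l) + dist (c l) (c r) + dist (c r) (c b)"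
    using dist_triangle[of "c a" "c b" "c l"] dist_triangle[of "c l" "c b" "c r"] by linarith
  moreover have "dist (c r) (c b) \<le> v * dist r b"
    using l by (intro lipschitz_onD[OF lip]) auto
  ultimately show ?case using l by (simp add: dist_real_def algebra_simps)
qed

text \<open>The set where the lower metric derivative is at most \<open>q\<close>, witnessed by parameters in \<open>I\<close>.\<close>

definition slow_set :: "(real \<Rightarrow> 'a::metric_space) \<Rightarrow> real set \<Rightarrow> real \<Rightarrow> real set" where
  "slow_set c I q = {\<sigma>. \<forall>d>0. \<exists>s\<in>I. s \<noteq> \<sigma> \<and> \<bar>s - \<sigma>\<bar> < d \<and> dist (c s) (c \<sigma>) \<le> q * \<bar>s - \<sigma>\<bar>}"

text \<open>Points of the slow set lie in arbitrarily short intervals whose defect is at least \<open>v - q\<close> times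
their length. Vitali's theorem selects disjoint ones that still cover almost all of the slow set,
and superadditivity of the defect bounds their total length.\<close>

lemma slow_set_cover:
  fixes c :: "real \<Rightarrow> 'a::metric_space"
  assumes lip: "v-lipschitz_on {a..b} c" and "q < v" "a \<le> b"
  shows "\<exists>T. slow_set c I q \<inter> {a..b} \<subseteq> T \<and> T \<in> lmeasurable \<and>
             measure lebesgue T \<le> (v * (b - a) - dist (c a) (c b)) / (v - q)"
proof -
  define B where "B = (v * (b - a) - dist (c a) (c b)) / (v - q)"
  define K where "K = {(l, r). a \<le> l \<and> l < r \<and> r \<le> b \<and> dist (c l) (c r) \<le> q * (r - l)}"
  define ctr rad where "ctr p = (fst p + snd p) / 2" and "rad p = (snd p - fst p) / 2" for p :: "real \<times> real"
  have cball: "cball (ctr p) (rad p) = {fst p..snd p}" for p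
    by (auto simp: cball_eq_atLeastAtMost ctr_def rad_def field_simps)
  define S where "S = slow_set c I q \<inter> {a<..<b}"
  obtain C where C: "countable C" "C \<subseteq> K"
    "pairwise (\<lambda>i j. disjnt (cball (ctr i) (rad i)) (cball (ctr j) (rad j))) C"
    "negligible (S - (\<Union>i\<in>C. cball (ctr i) (rad i)))"
  proof (rule Vitali_covering_theorem_cballs[of K rad S ctr])
    show "0 < rad i" if "i \<in> K" for i using that by (auto simp: K_def rad_def)
    show "\<exists>i. i \<in> K \<and> x \<in> cball (ctr i) (rad i) \<and> rad i < d" if "x \<in> S" "0 < d" for x d
    proof -
      have x: "a < x" "x < b" "x \<in> slow_set c I q" using that by (auto simp: S_def)
      then have "min d (min (x - a) (b - x)) > 0" using \<open>d > 0\<close> by simp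
      then obtain s where s: "s \<noteq> x" "\<bar>s - x\<bar> < min d (min (x - a) (b - x))"
        "dist (c s) (c x) \<le> q * \<bar>s - x\<bar>"
        using x(3) unfolding slow_set_def by blast
      then have "(min s x, max s x) \<in> K \<and> x \<in> cball (ctr (min s x, max s x)) (rad (min s x, max s x))
          \<and> rad (min s x, max s x) < d"
        unfolding cball by (auto simp: K_def rad_def min_def max_def dist_commute abs_if split: if_splits)
      then show ?thesis by blast
    qed
  qed blast
  have bound: "measure lebesgue (\<Union>p\<in>F. {fst p..snd p}) \<le> B" if "F \<subseteq> C" "finite F" for F
  proof -
    have K: "a \<le> l \<and> l < r \<and> r \<le> b \<and> dist (c l) (c r) \<le> q * (r - l)" if "(l, r) \<in> F" for l r
      using that \<open>F \<subseteq> C\<close> C(2) by (auto simp: K_def)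
    have "measure lebesgue (\<Union>p\<in>F. {fst p..snd p}) \<le> (\<Sum>p\<in>F. measure lebesgue {fst p..snd p})"
      using that by (intro measure_UNION_le) auto
    also have "\<dots> = (\<Sum>(l, r)\<in>F. r - l)"
      by (rule sum.cong) (use K in force)+
    also have "\<dots> \<le> B"
    proof -
      have "(\<Sum>(l, r)\<in>F. r - l) * (v - q) = (\<Sum>(l, r)\<in>F. (r - l) * (v - q))"
        by (simp add: sum_distrib_right case_prod_unfold)
      also have "\<dots> \<le> (\<Sum>(l, r)\<in>F. v * (r - l) - dist (c l) (c r))"
        by (rule sum_mono) (use K in \<open>force simp: algebra_simps\<close>)
      also have "\<dots> \<le> v * (b - a) - dist (c a) (c b)"
        using pairwise_subset[OF C(3) \<open>F \<subseteq> C\<close>] K \<open>a \<le> b\<close> \<open>finite F\<close>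
        unfolding cball by (intro sum_defect_le[OF lip]) auto
      finally show ?thesis using \<open>q < v\<close> by (simp add: B_def field_simps)
    qed
    finally show ?thesis .
  qed
  define W where "W = (\<Union>p\<in>C. {fst p..snd p})"
  have meas: "{fst p..snd p} \<in> lmeasurable" for p :: "real \<times> real"
    by (simp add: lmeasurable_compact)
  have "W \<in> lmeasurable" "measure lebesgue W \<le> B"
    unfolding W_def
    by (rule fmeasurable_UN_bound[OF C(1) meas bound] measure_UN_bound[OF C(1) meas bound]; assumption)+
  moreover define E where "E = S - W \<union> {a, b}"
  have "negligible E"
    using C(4) by (simp add: cball W_def E_def)
  then have E: "E \<in> lmeasurable" "measure lebesgue E = 0"
    by (rule negligible_imp_measurable negligible_imp_measure0)+
  ultimately have "W \<union> E \<in> lmeasurable" "measure lebesgue (W \<union> E) \<le> B"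
    using measure_Un_le[of W lebesgue E] by (auto intro: fmeasurable.Un)
  moreover have "slow_set c I q \<inter> {a..b} \<subseteq> W \<union> E"
    by (auto simp: S_def E_def)
  ultimately show ?thesis unfolding B_def by blast
qed

lemma slow_set_cover_partition:
  fixes c :: "real \<Rightarrow> 'a::metric_space"
  assumes lip: "v-lipschitz_on {a..b} c" and "q < v"
    and "sorted ts" "set ts \<subseteq> {a..b}" "ts \<noteq> []"
  shows "\<exists>T. slow_set c I q \<inter> {hd ts..last ts} \<subseteq> T \<and> T \<in> lmeasurable \<and>
             measure lebesgue T \<le> (v * (last ts - hd ts) - chord_sum c ts) / (v - q)"
  using assms
proof (induction c ts rule: chord_sum.induct)
  case (2 c x)
  then show ?case by (intro exI[of _ "{x}"]) (auto intro: lmeasurable_compact)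
next
  case (3 c x y ts)
  have "v-lipschitz_on {x..y} c"
    using 3 by (intro lipschitz_on_subset[OF \<open>v-lipschitz_on {a..b} c\<close>]) auto
  then obtain T1 where T1: "slow_set c I q \<inter> {x..y} \<subseteq> T1" "T1 \<in> lmeasurable"
      "measure lebesgue T1 \<le> (v * (y - x) - dist (c x) (c y)) / (v - q)"
    using slow_set_cover[of v x y c q I] 3 by auto
  have "\<exists>T. slow_set c I q \<inter> {hd (y # ts)..last (y # ts)} \<subseteq> T \<and> T \<in> lmeasurable \<and>
      measure lebesgue T \<le> (v * (last (y # ts) - hd (y # ts)) - chord_sum c (y # ts)) / (v - q)"
    using 3 by (intro 3(1)) auto
  then obtain T2 where T2: "slow_set c I q \<inter> {y..last (y # ts)} \<subseteq> T2" "T2 \<in> lmeasurable"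
      "measure lebesgue T2 \<le> (v * (last (y # ts) - y) - chord_sum c (y # ts)) / (v - q)"
    by auto
  have "measure lebesgue (T1 \<union> T2) \<le> measure lebesgue T1 + measure lebesgue T2"
    using T1 T2 by (intro measure_Un_le) auto
  also have "\<dots> \<le> (v * (y - x) - dist (c x) (c y)) / (v - q)
      + (v * (last (y # ts) - y) - chord_sum c (y # ts)) / (v - q)"
    using T1(3) T2(3) by simp
  also have "\<dots> = (v * (last (x # y # ts) - hd (x # y # ts)) - chord_sum c (x # y # ts)) / (v - q)"
    by (simp add: add_divide_distrib[symmetric] algebra_simps)
  finally have "measure lebesgue (T1 \<union> T2)
    \<le> (v * (last (x # y # ts) - hd (x # y # ts)) - chord_sum c (x # y # ts)) / (v - q)" .
  moreover have "{hd (x # y # ts)..last (x # y # ts)} \<subseteq> {x..y} \<union> {y..last (y # ts)}"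
    by auto
  then have "slow_set c I q \<inter> {hd (x # y # ts)..last (x # y # ts)} \<subseteq> T1 \<union> T2"
    using T1(1) T2(1) by blast
  ultimately show ?case
    using T1(2) T2(2) by (intro exI[of _ "T1 \<union> T2"] conjI fmeasurable.Un)
qed simp

text \<open>The total defect over a partition is \<open>v (b - a)\<close> minus its chord sum, which is arbitrarily small.
Hence all slow sets with \<open>q < v\<close> are null, and above \<open>v\<close> the Lipschitz bound takes over.\<close>

lemma AE_speed_eq_lipschitz:
  fixes c :: "real \<Rightarrow> 'a::metric_space"
  assumes lip: "v-lipschitz_on {a..b} c" and "a \<le> b"
    and approx: "\<And>\<eta>. \<eta> > 0 \<Longrightarrow> \<exists>ts. sorted ts \<and> set ts \<subseteq> {a..b} \<and> v * (b - a) - \<eta> < chord_sum c ts"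
  shows "AE \<sigma> in lborel. a < \<sigma> \<and> \<sigma> < b \<longrightarrow>
           ((\<lambda>s. dist (c s) (c \<sigma>) / \<bar>s - \<sigma>\<bar>) \<longlongrightarrow> v) (at \<sigma>)"
proof -
  \<comment> \<open>Countably many thresholds below \<open>v\<close> suffice.\<close>
  define Q where "Q n = v - 1 / real (Suc n)" for n
  have "negligible (slow_set c {a..b} (Q n) \<inter> {a..b})" for n
    unfolding negligible_outer_le
  proof (intro allI impI)
    fix e :: real assume "e > 0"
    have "v - Q n > 0" by (simp add: Q_def)
    then obtain ts where ts: "sorted ts" "set ts \<subseteq> {a..b}" "v * (b - a) - e * (v - Q n) < chord_sum c ts"
      using approx[of "e * (v - Q n)"] \<open>e > 0\<close> by auto
    define us where "us = a # ts @ [b]"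
    have "sorted us" "set us \<subseteq> {a..b}" using ts \<open>a \<le> b\<close> by (auto simp: us_def sorted_append)
    then obtain T where T: "slow_set c {a..b} (Q n) \<inter> {a..b} \<subseteq> T" "T \<in> lmeasurable"
      "measure lebesgue T \<le> (v * (b - a) - chord_sum c us) / (v - Q n)"
      using slow_set_cover_partition[OF lip, of "Q n" us "{a..b}"] \<open>v - Q n > 0\<close>
      by (auto simp: us_def)
    note T(3)
    also have "chord_sum c ts \<le> chord_sum c us"
      using chord_sum_insert[of c ts "[]" b] chord_sum_insert[of c "[]" "ts @ [b]" a]
      by (simp add: us_def)
    then have "(v * (b - a) - chord_sum c us) / (v - Q n) \<le> e"
      using ts(3) \<open>v - Q n > 0\<close> by (simp add: pos_divide_le_eq)
    finally show "\<exists>T. slow_set c {a..b} (Q n) \<inter> {a..b} \<subseteq> T \<and> T \<in> lmeasurable \<and> measure lebesgue T \<le> e"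
      using T by blast
  qed
  then have "AE \<sigma> in lebesgue. \<forall>n. \<sigma> \<notin> slow_set c {a..b} (Q n) \<inter> {a..b}"
    unfolding AE_all_countable negligible_iff_null_sets by (intro allI AE_not_in)
  then have "AE \<sigma> in lborel. \<forall>n. \<sigma> \<notin> slow_set c {a..b} (Q n) \<inter> {a..b}"
    by (simp add: AE_completion_iff)
  then show ?thesis
  proof eventually_elim
    case (elim \<sigma>)
    show ?case
    proof (intro impI order_tendstoI)
      fix q assume \<sigma>: "a < \<sigma> \<and> \<sigma> < b" and "v < q"
      have "eventually (\<lambda>s. s \<in> {a<..<b} \<and> s \<noteq> \<sigma>) (at \<sigma>)"
        using \<sigma> by (intro eventually_conj eventually_at_in_open' eventually_neq_at_within) auto
      then show "eventually (\<lambda>s. dist (c s) (c \<sigma>) / \<bar>s - \<sigma>\<bar> < q) (at \<sigma>)"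
      proof eventually_elim
        case (elim s)
        have "dist (c s) (c \<sigma>) \<le> v * dist s \<sigma>"
          using elim \<sigma> by (intro lipschitz_onD[OF lip]) auto
        then have "dist (c s) (c \<sigma>) / \<bar>s - \<sigma>\<bar> \<le> v"
          using elim by (simp add: dist_real_def pos_divide_le_eq)
        with \<open>v < q\<close> show ?case by simp
      qed
    next
      fix q assume \<sigma>: "a < \<sigma> \<and> \<sigma> < b" and "q < v"
      then obtain n where n: "1 / real (Suc n) < v - q"
        using reals_Archimedean[of "v - q"] by (auto simp: inverse_eq_divide)
      have "\<sigma> \<notin> slow_set c {a..b} (Q n)" using elim \<sigma> by force
      then obtain d where d: "d > 0"
        "\<And>s. s \<in> {a..b} \<Longrightarrow> s \<noteq> \<sigma> \<Longrightarrow> \<bar>s - \<sigma>\<bar> < d \<Longrightarrow> Q n * \<bar>s - \<sigma>\<bar> < dist (c s) (c \<sigma>)"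
        unfolding slow_set_def by force
      have "eventually (\<lambda>s. s \<in> {a<..<b} \<and> s \<in> ball \<sigma> d \<and> s \<noteq> \<sigma>) (at \<sigma>)"
        using \<sigma> d(1) by (intro eventually_conj eventually_at_in_open' eventually_neq_at_within) auto
      then show "eventually (\<lambda>s. q < dist (c s) (c \<sigma>) / \<bar>s - \<sigma>\<bar>) (at \<sigma>)"
      proof eventually_elim
        case (elim s)
        then have "Q n * \<bar>s - \<sigma>\<bar> < dist (c s) (c \<sigma>)"
          by (intro d(2)) (auto simp: dist_real_def)
        then have "Q n < dist (c s) (c \<sigma>) / \<bar>s - \<sigma>\<bar>"
          using elim by (simp add: pos_less_divide_eq)
        with n show ?case by (simp add: Q_def)
      qed
    qed
  qed
qed

text \<open>Since \<open>dist x y\<close> is strictly less than \<open>b - a\<close>, there is a path from \<open>x\<close> to \<open>y\<close> shorter than \<open>b - a\<close>;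
traversing it in time \<open>b - a\<close> requires a constant speed of at most one.\<close>

lemma constant_speed_curve_exists:
  fixes x y :: "'a::metric_space"
  assumes "length_space TYPE('a)" and "a < b" and "dist x y < b - a"
  obtains c v where "0 \<le> v" "v \<le> 1" "v-lipschitz_on {a..b} c" "c a = x" "c b = y"
    "AE \<sigma> in lborel. a < \<sigma> \<and> \<sigma> < b \<longrightarrow> ((\<lambda>s. dist (c s) (c \<sigma>) / \<bar>s - \<sigma>\<bar>) \<longlongrightarrow> v) (at \<sigma>)"
proof -
  obtain c v where c: "0 \<le> v" "v \<le> 1" "v-lipschitz_on {a..b} c" "c a = x" "c b = y"
    and approx: "\<And>\<eta>. \<eta> > 0 \<Longrightarrow> \<exists>ts. sorted ts \<and> set ts \<subseteq> {a..b} \<and> v * (b - a) - \<eta> < chord_sum c ts"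
    by (rule proportional_arclength_curve[OF assms], rule that)
  have "AE \<sigma> in lborel. a < \<sigma> \<and> \<sigma> < b \<longrightarrow> ((\<lambda>s. dist (c s) (c \<sigma>) / \<bar>s - \<sigma>\<bar>) \<longlongrightarrow> v) (at \<sigma>)"
    by (rule AE_speed_eq_lipschitz[OF c(3) less_imp_le[OF \<open>a < b\<close>] approx])
  then show ?thesis by (rule that[OF c])
qed

section \<open>Concatenating curves of constant speed\<close>

lemma has_metric_speed_cong:
  assumes "open S" "\<sigma> \<in> S" "\<And>s. s \<in> S \<Longrightarrow> \<gamma> s = \<gamma>' s"
  shows "has_metric_speed \<gamma> v \<sigma> \<longleftrightarrow> has_metric_speed \<gamma>' v \<sigma>"
  unfolding has_metric_speed_def
proof (rule filterlim_cong[OF refl refl])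
  have "eventually (\<lambda>s. s \<in> S) (at \<sigma> within {0..})"
    using assms(1,2) by (auto simp: eventually_at_topological)
  then show "eventually (\<lambda>s. dist (\<gamma> s) (\<gamma> \<sigma>) / \<bar>s - \<sigma>\<bar> = dist (\<gamma>' s) (\<gamma>' \<sigma>) / \<bar>s - \<sigma>\<bar>)
      (at \<sigma> within {0..})"
    by eventually_elim (use assms(2,3) in simp)
qed

lemma has_metric_speed_const: "has_metric_speed (\<lambda>_. x) 0 \<sigma>"
  by (simp add: has_metric_speed_def)

text \<open>Curves built from finitely many moves at constant speed at most one, the last of which ends at time
\<open>h\<close>. Zero moves are allowed, so that the constant curve is a starting point for concatenation.\<close>

definition piecewise_constant_speed :: "(real \<Rightarrow> 'a::metric_space) \<Rightarrow> real \<Rightarrow> bool" where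
  "piecewise_constant_speed \<gamma> h \<longleftrightarrow>
     1-lipschitz_on {0..} \<gamma> \<and> (\<forall>s\<ge>h. \<gamma> s = \<gamma> h) \<and>
     (\<exists>(n::nat) r. r 0 = 0 \<and> r n = h \<and> (\<forall>i<n. r i < r (Suc i)) \<and>
        (\<forall>i<n. \<exists>v. 0 \<le> v \<and> v \<le> 1 \<and>
           (AE \<sigma> in lborel. r i < \<sigma> \<and> \<sigma> < r (Suc i) \<longrightarrow> has_metric_speed \<gamma> v \<sigma>)))"

lemma piecewise_constant_speed_const: "piecewise_constant_speed (\<lambda>_. x) 0"
  unfolding piecewise_constant_speed_def
proof (intro conjI exI[of _ "0::nat"] exI[of _ "\<lambda>_. 0::real"])
  show "1-lipschitz_on {0..} (\<lambda>_. x)" by (rule lipschitz_onI) auto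
qed simp_all

lemma piecewise_constant_speed_lipschitz:
  "piecewise_constant_speed \<gamma> h \<Longrightarrow> 1-lipschitz_on {0..} \<gamma>"
  unfolding piecewise_constant_speed_def by blast

lemma piecewise_constant_speed_after:
  "piecewise_constant_speed \<gamma> h \<Longrightarrow> h \<le> s \<Longrightarrow> \<gamma> s = \<gamma> h"
  unfolding piecewise_constant_speed_def by blast

lemma breakpoints_mono:
  fixes r :: "nat \<Rightarrow> real"
  assumes "\<And>i. i < n \<Longrightarrow> r i < r (Suc i)" "i \<le> j" "j \<le> n"
  shows "r i \<le> r j"
  using assms(2,3)
proof (induction j)
  case (Suc j)
  show ?case
  proof (cases "i = Suc j")
    case False
    then have "r i \<le> r j" using Suc by simp
    also have "r j < r (Suc j)" using assms(1)[of j] Suc.prems by simp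
    finally show ?thesis by simp
  qed simp
qed simp

lemma piecewise_constant_speed_extend:
  fixes \<gamma> :: "real \<Rightarrow> 'a::metric_space"
  assumes ls: "length_space TYPE('a)" and \<gamma>: "piecewise_constant_speed \<gamma> h" and "0 \<le> h"
    and "h < h'" and y: "dist (\<gamma> h) y < h' - h"
  obtains \<gamma>' where "piecewise_constant_speed \<gamma>' h'" "\<And>s. s \<le> h \<Longrightarrow> \<gamma>' s = \<gamma> s" "\<gamma>' h' = y"
proof -
  obtain c v where v: "0 \<le> v" "v \<le> 1" and c: "v-lipschitz_on {h..h'} c" "c h = \<gamma> h" "c h' = y"
    and c_speed: "AE \<sigma> in lborel. h < \<sigma> \<and> \<sigma> < h' \<longrightarrow>
      ((\<lambda>s. dist (c s) (c \<sigma>) / \<bar>s - \<sigma>\<bar>) \<longlongrightarrow> v) (at \<sigma>)"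
    by (rule constant_speed_curve_exists[OF ls \<open>h < h'\<close> y], rule that)
  obtain n :: nat and r where r: "r 0 = 0" "r n = h" "\<forall>i<n. r i < r (Suc i)"
    and pieces: "\<forall>i<n. \<exists>v. 0 \<le> v \<and> v \<le> 1 \<and>
           (AE \<sigma> in lborel. r i < \<sigma> \<and> \<sigma> < r (Suc i) \<longrightarrow> has_metric_speed \<gamma> v \<sigma>)"
    using \<gamma> unfolding piecewise_constant_speed_def by blast
  define \<gamma>' where "\<gamma>' s = (if s \<le> h then \<gamma> s else if s \<le> h' then c s else y)" for s
  define r' where "r' = r(Suc n := h')"
  have lip: "1-lipschitz_on {0..} \<gamma>'"
  proof (rule lipschitz_on_leI)
    fix s t :: real assume "s \<in> {0..}" "t \<in> {0..}" "s \<le> t"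
    have L1: "1-lipschitz_on {0..h} \<gamma>"
      using piecewise_constant_speed_lipschitz[OF \<gamma>] by (rule lipschitz_on_subset) auto
    have L2: "1-lipschitz_on {h..h'} c"
      by (rule lipschitz_on_mono[OF c(1) subset_refl \<open>v \<le> 1\<close>])
    have L3: "1-lipschitz_on {h'..max t h'} (\<lambda>_. y)"
      by (rule lipschitz_onI) auto
    have "1-lipschitz_on {0..max t h'} (\<lambda>s. if s \<le> h' then (if s \<le> h then \<gamma> s else c s) else y)"
      by (rule lipschitz_on_concat[OF lipschitz_on_concat[OF L1 L2] L3]) (use c \<open>h < h'\<close> in auto)
    then have "dist (if s \<le> h' then (if s \<le> h then \<gamma> s else c s) else y)
       (if t \<le> h' then (if t \<le> h then \<gamma> t else c t) else y) \<le> 1 * dist s t"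
      by (rule lipschitz_onD) (use \<open>s \<in> _\<close> \<open>s \<le> t\<close> in auto)
    moreover have "\<gamma>' z = (if z \<le> h' then (if z \<le> h then \<gamma> z else c z) else y)" for z
      using \<open>h < h'\<close> by (simp add: \<gamma>'_def)
    ultimately show "dist (\<gamma>' s) (\<gamma>' t) \<le> 1 * dist s t" by simp
  qed simp
  have old: "\<exists>v. 0 \<le> v \<and> v \<le> 1 \<and>
      (AE \<sigma> in lborel. r' i < \<sigma> \<and> \<sigma> < r' (Suc i) \<longrightarrow> has_metric_speed \<gamma>' v \<sigma>)" if i: "i < n" for i
  proof -
    obtain w where w: "0 \<le> w" "w \<le> 1"
      "AE \<sigma> in lborel. r i < \<sigma> \<and> \<sigma> < r (Suc i) \<longrightarrow> has_metric_speed \<gamma> w \<sigma>"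
      using pieces i by blast
    have "r (Suc i) \<le> h"
      using breakpoints_mono[of n r "Suc i" n] r i by auto
    have "AE \<sigma> in lborel. r' i < \<sigma> \<and> \<sigma> < r' (Suc i) \<longrightarrow> has_metric_speed \<gamma>' w \<sigma>"
      using w(3)
    proof eventually_elim
      case (elim \<sigma>)
      show ?case
      proof
        assume \<sigma>: "r' i < \<sigma> \<and> \<sigma> < r' (Suc i)"
        then have "has_metric_speed \<gamma> w \<sigma>" "\<sigma> < h"
          using elim i \<open>r (Suc i) \<le> h\<close> by (auto simp: r'_def)
        then show "has_metric_speed \<gamma>' w \<sigma>"
          using has_metric_speed_cong[of "{..<h}" \<sigma> \<gamma> \<gamma>' w] by (simp add: \<gamma>'_def)
      qed
    qed
    with w show ?thesis by blast
  qed
  have new: "AE \<sigma> in lborel. r' n < \<sigma> \<and> \<sigma> < r' (Suc n) \<longrightarrow> has_metric_speed \<gamma>' v \<sigma>"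
    using c_speed
  proof eventually_elim
    case (elim \<sigma>)
    show ?case
    proof
      assume "r' n < \<sigma> \<and> \<sigma> < r' (Suc n)"
      then have \<sigma>: "h < \<sigma>" "\<sigma> < h'" by (auto simp: r'_def r)
      with elim have "((\<lambda>s. dist (c s) (c \<sigma>) / \<bar>s - \<sigma>\<bar>) \<longlongrightarrow> v) (at \<sigma> within {0..})"
        by (auto intro: tendsto_within_subset)
      then have "has_metric_speed c v \<sigma>" by (simp add: has_metric_speed_def)
      then show "has_metric_speed \<gamma>' v \<sigma>"
        using has_metric_speed_cong[of "{h<..<h'}" \<sigma> c \<gamma>' v] \<sigma> by (simp add: \<gamma>'_def)
    qed
  qed
  show ?thesis
  proof (rule that[of \<gamma>'])
    show "\<gamma>' s = \<gamma> s" if "s \<le> h" for s using that by (simp add: \<gamma>'_def)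
    show "\<gamma>' h' = y" using \<open>h < h'\<close> c by (simp add: \<gamma>'_def)
    show "piecewise_constant_speed \<gamma>' h'"
      unfolding piecewise_constant_speed_def
    proof (intro conjI exI[of _ "Suc n"] exI[of _ r'] lip)
      show "\<forall>s\<ge>h'. \<gamma>' s = \<gamma>' h'" using \<open>h < h'\<close> c by (auto simp: \<gamma>'_def)
      show "r' 0 = 0" "r' (Suc n) = h'" using r by (auto simp: r'_def)
      show "\<forall>i<Suc n. r' i < r' (Suc i)" using r \<open>h < h'\<close> by (auto simp: r'_def less_Suc_eq)
      show "\<forall>i<Suc n. \<exists>v. 0 \<le> v \<and> v \<le> 1 \<and>
           (AE \<sigma> in lborel. r' i < \<sigma> \<and> \<sigma> < r' (Suc i) \<longrightarrow> has_metric_speed \<gamma>' v \<sigma>)"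
        using old new v unfolding less_Suc_eq by blast
    qed
  qed
qed

lemma lipschitz_abs_cont_curve:
  assumes "1-lipschitz_on I \<gamma>"
  shows "abs_cont_curve_on I \<gamma>"
  unfolding abs_cont_curve_on_def
proof (intro exI[of _ "\<lambda>_. 1"] conjI ballI impI)
  fix a b :: real assume ab: "a \<in> I" "b \<in> I" "a \<le> b"
  show "set_integrable lborel {a..b} (\<lambda>_. 1::real)"
    by (auto simp: set_integrable_def emeasure_lborel_Icc_eq intro!: integrable_real_indicator)
  have "(LINT s:{a..b}|lborel. 1) = b - a"
    using ab by (simp add: set_lebesgue_integral_def)
  then show "dist (\<gamma> a) (\<gamma> b) \<le> (LINT s:{a..b}|lborel. 1)"
    using lipschitz_onD[OF assms, of a b] ab by (simp add: dist_real_def)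
qed simp

text \<open>An extra breakpoint at \<open>h + 1\<close> accounts for the curve without moves, as admissibility asks for at
least one breakpoint after \<open>0\<close>.\<close>

lemma piecewise_constant_speed_admissible:
  fixes \<gamma> :: "real \<Rightarrow> 'a::metric_space"
  assumes f: "continuous_on UNIV f" and \<gamma>: "piecewise_constant_speed \<gamma> h" and "0 \<le> h"
  shows "\<gamma> \<in> admissible_curves f (\<gamma> 0)"
proof -
  have lip: "1-lipschitz_on {0..} \<gamma>" using \<gamma> by (rule piecewise_constant_speed_lipschitz)
  obtain n :: nat and r where r: "r 0 = 0" "r n = h" "\<forall>i<n. r i < r (Suc i)"
    and pieces: "\<forall>i<n. \<exists>v. 0 \<le> v \<and> v \<le> 1 \<and>
           (AE \<sigma> in lborel. r i < \<sigma> \<and> \<sigma> < r (Suc i) \<longrightarrow> has_metric_speed \<gamma> v \<sigma>)"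
    using \<gamma> unfolding piecewise_constant_speed_def by blast
  have cont: "continuous_on I (\<lambda>\<sigma>. lagrangian f (\<gamma> \<sigma>) v)" if "v \<le> 1" "I \<subseteq> {0..}" for v I
  proof -
    have "continuous_on I \<gamma>"
      using lipschitz_on_continuous_on[OF lip] that(2) by (rule continuous_on_subset)
    then have "continuous_on I (\<lambda>\<sigma>. f (\<gamma> \<sigma>))"
      by (rule continuous_on_compose2[OF f]) auto
    with that(1) show ?thesis by (simp add: lagrangian_eq continuous_on_ereal)
  qed
  have r0: "0 \<le> r i" if "i \<le> n" for i
    using breakpoints_mono[of n r 0 i] r that by auto
  have ok: "piece_ok f \<gamma> {r i..r (Suc i)}" if i: "i < n" for i
  proof -
    obtain w where w: "0 \<le> w" "w \<le> 1"
      "AE \<sigma> in lborel. r i < \<sigma> \<and> \<sigma> < r (Suc i) \<longrightarrow> has_metric_speed \<gamma> w \<sigma>"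
      using pieces i by blast
    have "AE \<sigma> in lborel. \<sigma> \<in> {r i..r (Suc i)} \<longrightarrow> has_metric_speed \<gamma> w \<sigma>"
      using w(3) AE_lborel_neq[of "r i"] AE_lborel_neq[of "r (Suc i)"]
      by eventually_elim force
    with w cont[of w "{r i..r (Suc i)}"] r0[of i] i show ?thesis
      unfolding piece_ok_def by auto
  qed
  have rest: "piece_ok f \<gamma> I" if "I \<subseteq> {h..}" for I
    unfolding piece_ok_def
  proof (intro exI[of _ 0] conjI)
    show "AE \<sigma> in lborel. \<sigma> \<in> I \<longrightarrow> has_metric_speed \<gamma> 0 \<sigma>"
      using AE_lborel_neq[of h]
    proof eventually_elim
      case (elim \<sigma>)
      show ?case
      proof
        assume "\<sigma> \<in> I"
        then have "h < \<sigma>" using elim that by force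
        have after: "\<gamma> s = \<gamma> h" if "s \<in> {h<..}" for s
          using that by (intro piecewise_constant_speed_after[OF \<gamma>]) simp
        show "has_metric_speed \<gamma> 0 \<sigma>"
          by (rule iffD2[OF has_metric_speed_cong[OF open_greaterThan _ after] has_metric_speed_const])
             (use \<open>h < \<sigma>\<close> in simp)
      qed
    qed
    show "continuous_on I (\<lambda>\<sigma>. lagrangian f (\<gamma> \<sigma>) 0)"
      using that \<open>0 \<le> h\<close> by (intro cont) (auto intro: order_trans)
  qed simp
  define r' where "r' = r(Suc n := h + 1)"
  have breakpoints: "\<exists>(n::nat) r. 1 \<le> n \<and> r 0 = 0 \<and> (\<forall>i<n. r i < r (Suc i)) \<and>
            (\<forall>i<n. piece_ok f \<gamma> {r i..r (Suc i)}) \<and> piece_ok f \<gamma> {r n..}"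
  proof (intro exI[of _ "Suc n"] exI[of _ r'] conjI)
    show "r' 0 = 0" using r(1) by (simp add: r'_def)
    show "\<forall>i<Suc n. r' i < r' (Suc i)" using r by (auto simp: r'_def less_Suc_eq)
    show "\<forall>i<Suc n. piece_ok f \<gamma> {r' i..r' (Suc i)}"
      using ok rest[of "{h..h+1}"] r(2) by (auto simp: r'_def less_Suc_eq)
    show "piece_ok f \<gamma> {r' (Suc n)..}"
      by (rule rest) (auto simp: r'_def)
  qed simp
  show ?thesis
    unfolding admissible_curves_def mem_Collect_eq
    by (intro conjI refl lipschitz_abs_cont_curve[OF lip] breakpoints)
qed

section \<open>The subslope\<close>

text \<open>The two halves of \<open>|D\<^sup>-v| = f + k\<close>, where \<open>v = u + k t\<close>, written without quotients and with \<open>k\<close>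
cancelled.\<close>

definition slope_upper :: "('a::metric_space \<Rightarrow> real) \<Rightarrow> ('a \<times> real \<Rightarrow> real) \<Rightarrow> 'a \<Rightarrow> real \<Rightarrow> bool" where
  "slope_upper f u x t \<longleftrightarrow> (\<forall>e>0. eventually (\<lambda>\<delta>. \<forall>y. dist x y \<le> \<delta> \<longrightarrow>
     u (x, t) - u (y, t - \<delta>) \<le> (f x + e) * \<delta>) (at_right 0))"

definition slope_lower :: "('a::metric_space \<Rightarrow> real) \<Rightarrow> ('a \<times> real \<Rightarrow> real) \<Rightarrow> 'a \<Rightarrow> real \<Rightarrow> bool" where
  "slope_lower f u x t \<longleftrightarrow> (\<forall>e>0. frequently (\<lambda>\<delta>. \<exists>y. dist x y \<le> \<delta> \<and>
     (f x - e) * \<delta> \<le> u (x, t) - u (y, t - \<delta>)) (at_right 0))"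

lemma subslope_eq_iff_slopes:
  fixes u :: "'a::metric_space \<times> real \<Rightarrow> real"
  shows "subslope (\<lambda>(y, s). u (y, s) + k * s) x t = ereal (f x + k) \<longleftrightarrow>
    slope_upper f u x t \<and> slope_lower f u x t"
proof -
  define c where "c = f x"
  let ?S = "subslope (\<lambda>(y, s). u (y, s) + k * s) x t"
  let ?U = "\<forall>e>0. eventually (\<lambda>\<delta>. \<forall>y. dist x y \<le> \<delta> \<longrightarrow>
    u (x, t) - u (y, t - \<delta>) \<le> (c + e) * \<delta>) (at_right 0)"
  let ?L = "\<forall>e>0. frequently (\<lambda>\<delta>. \<exists>y. dist x y \<le> \<delta> \<and>
    (c - e) * \<delta> \<le> u (x, t) - u (y, t - \<delta>)) (at_right 0)"
  define Q where "Q \<delta> = (SUP y \<in> {y. dist x y \<le> \<delta>}.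
    ereal ((u (x, t) + k * t - (u (y, t - \<delta>) + k * (t - \<delta>))) / \<delta>))" for \<delta>
  have S: "?S = Limsup (at_right 0) Q" unfolding subslope_def Q_def[abs_def] by simp
  have quot: "(u (x, t) + k * t - (u (y, t - \<delta>) + k * (t - \<delta>))) / \<delta> = (u (x, t) - u (y, t - \<delta>)) / \<delta> + k"
    if "\<delta> > 0" for y \<delta> using that by (simp add: field_simps)
  have pos: "eventually (\<lambda>\<delta>::real. 0 < \<delta>) (at_right 0)" by (rule eventually_at_right_less)
  have le: "?S \<le> ereal (c + k) \<longleftrightarrow> ?U"
  proof
    assume le: "?S \<le> ereal (c + k)"
    show ?U
    proof (intro allI impI)
      fix e :: real assume "e > 0"
      have "Limsup (at_right 0) Q < ereal (c + k + e)"
        by (rule le_less_trans[OF le[unfolded S]]) (use \<open>e > 0\<close> in simp)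
      then have "eventually (\<lambda>\<delta>. Q \<delta> < ereal (c + k + e)) (at_right 0)" by (rule Limsup_lessD)
      then show "eventually (\<lambda>\<delta>. \<forall>y. dist x y \<le> \<delta> \<longrightarrow> u (x, t) - u (y, t - \<delta>) \<le> (c + e) * \<delta>) (at_right 0)"
        using pos
      proof eventually_elim
        case (elim \<delta>)
        show ?case
        proof (intro allI impI)
          fix y assume "dist x y \<le> \<delta>"
          then have "ereal ((u (x, t) + k * t - (u (y, t - \<delta>) + k * (t - \<delta>))) / \<delta>) \<le> Q \<delta>"
            unfolding Q_def by (intro SUP_upper) simp
          also have "Q \<delta> < ereal (c + k + e)" by (rule elim)
          finally show "u (x, t) - u (y, t - \<delta>) \<le> (c + e) * \<delta>"
            using elim(2) by (simp add: quot pos_divide_le_eq pos_less_divide_eq field_simps)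
        qed
      qed
    qed
  next
    assume U: ?U
    show "?S \<le> ereal (c + k)"
    proof (rule ereal_le_epsilon2)
      fix e :: real assume "e > 0"
      have "eventually (\<lambda>\<delta>. Q \<delta> \<le> ereal (c + k) + ereal e) (at_right 0)"
        using U[rule_format, OF \<open>e > 0\<close>] pos
      proof eventually_elim
        case (elim \<delta>)
        show ?case
          unfolding Q_def
        proof (rule SUP_least)
          fix y assume "y \<in> {y. dist x y \<le> \<delta>}"
          then have "u (x, t) - u (y, t - \<delta>) \<le> (c + e) * \<delta>" using elim(1) by simp
          then show "ereal ((u (x, t) + k * t - (u (y, t - \<delta>) + k * (t - \<delta>))) / \<delta>) \<le> ereal (c + k) + ereal e"
            using elim(2) by (simp add: quot pos_divide_le_eq field_simps)
        qed
      qed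
      then show "?S \<le> ereal (c + k) + ereal e" unfolding S by (rule Limsup_bounded)
    qed
  qed
  have ge: "ereal (c + k) \<le> ?S \<longleftrightarrow> ?L"
  proof
    assume ge: "ereal (c + k) \<le> ?S"
    show ?L
    proof (intro allI impI)
      fix e :: real assume "e > 0"
      show "frequently (\<lambda>\<delta>. \<exists>y. dist x y \<le> \<delta> \<and> (c - e) * \<delta> \<le> u (x, t) - u (y, t - \<delta>)) (at_right 0)"
      proof (rule ccontr)
        assume "\<not> ?thesis"
        then have "eventually (\<lambda>\<delta>. \<forall>y. dist x y \<le> \<delta> \<longrightarrow> u (x, t) - u (y, t - \<delta>) < (c - e) * \<delta>) (at_right 0)"
          unfolding frequently_def not_not by (rule eventually_mono) (meson not_le)
        then have "eventually (\<lambda>\<delta>. Q \<delta> \<le> ereal (c + k - e)) (at_right 0)"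
          using pos
        proof eventually_elim
          case (elim \<delta>)
          show ?case
            unfolding Q_def
          proof (rule SUP_least)
            fix y assume "y \<in> {y. dist x y \<le> \<delta>}"
            then have "u (x, t) - u (y, t - \<delta>) < (c - e) * \<delta>" using elim(1) by simp
            then show "ereal ((u (x, t) + k * t - (u (y, t - \<delta>) + k * (t - \<delta>))) / \<delta>) \<le> ereal (c + k - e)"
              using elim(2) by (simp add: quot pos_divide_le_eq field_simps)
          qed
        qed
        then have "?S \<le> ereal (c + k - e)" unfolding S by (rule Limsup_bounded)
        with ge have "ereal (c + k) \<le> ereal (c + k - e)" by (rule order_trans)
        with \<open>e > 0\<close> show False by simp
      qed
    qed
  next
    assume L: ?L
    show "ereal (c + k) \<le> ?S"
    proof (rule ereal_le_epsilon2)
      fix e :: real assume "e > 0"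
      have "\<not> ?S < ereal (c + k - e)"
      proof
        assume "?S < ereal (c + k - e)"
        then have "eventually (\<lambda>\<delta>. Q \<delta> < ereal (c + k - e)) (at_right 0)"
          unfolding S by (rule Limsup_lessD)
        then have "eventually (\<lambda>\<delta>. Q \<delta> < ereal (c + k - e) \<and> 0 < \<delta>) (at_right 0)"
          using pos by (rule eventually_conj)
        with L \<open>e > 0\<close> have "frequently (\<lambda>\<delta>. (Q \<delta> < ereal (c + k - e) \<and> 0 < \<delta>) \<and>
            (\<exists>y. dist x y \<le> \<delta> \<and> (c - e) * \<delta> \<le> u (x, t) - u (y, t - \<delta>))) (at_right 0)"
          by (intro frequently_eventually_conj) auto
        then obtain \<delta> y where \<delta>: "Q \<delta> < ereal (c + k - e)" "0 < \<delta>" "dist x y \<le> \<delta>"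
          "(c - e) * \<delta> \<le> u (x, t) - u (y, t - \<delta>)"
          by (auto dest: frequently_ex)
        have "ereal ((u (x, t) + k * t - (u (y, t - \<delta>) + k * (t - \<delta>))) / \<delta>) \<le> Q \<delta>"
          unfolding Q_def using \<delta>(3) by (intro SUP_upper) simp
        then have "ereal ((u (x, t) + k * t - (u (y, t - \<delta>) + k * (t - \<delta>))) / \<delta>) < ereal (c + k - e)"
          using \<delta>(1) by (rule le_less_trans)
        with \<delta>(2,4) show False by (simp add: quot field_simps)
      qed
      then have "ereal (c + k - e) \<le> ?S" by simp
      then have "ereal (c + k - e) + ereal e \<le> ?S + ereal e" by (rule add_right_mono)
      then show "ereal (c + k) \<le> ?S + ereal e" by simp
    qed
  qed
  show ?thesis
    unfolding slope_upper_def slope_lower_def c_def[symmetric]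
      order_eq_iff[of ?S "ereal (c + k)"] le ge by (rule refl)
qed

section \<open>The cost along a curve\<close>

lemma integral_le_const:
  fixes g :: "real \<Rightarrow> real"
  assumes "continuous_on {a..b} g" "a \<le> b" "\<And>r. a \<le> r \<Longrightarrow> r \<le> b \<Longrightarrow> g r \<le> c"
  shows "integral {a..b} g \<le> c * (b - a)"
proof -
  have "integral {a..b} g \<le> integral {a..b} (\<lambda>_. c)"
    by (rule integral_le) (use assms in \<open>auto intro: integrable_continuous_interval\<close>)
  with \<open>a \<le> b\<close> show ?thesis by (simp add: mult.commute)
qed

lemma integral_ge_const:
  fixes g :: "real \<Rightarrow> real"
  assumes "continuous_on {a..b} g" "a \<le> b" "\<And>r. a \<le> r \<Longrightarrow> r \<le> b \<Longrightarrow> c \<le> g r"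
  shows "c * (b - a) \<le> integral {a..b} g"
proof -
  have "integral {a..b} (\<lambda>_. c) \<le> integral {a..b} g"
    by (rule integral_le) (use assms in \<open>auto intro: integrable_continuous_interval\<close>)
  with \<open>a \<le> b\<close> show ?thesis by (simp add: mult.commute)
qed

lemma integral_split:
  fixes g :: "real \<Rightarrow> real"
  assumes "continuous_on {0..b} g" "0 \<le> a" "a \<le> b"
  shows "integral {0..b} g = integral {0..a} g + integral {a..b} g"
  using assms
  by (intro Henstock_Kurzweil_Integration.integral_combine[symmetric] integrable_continuous_interval) auto

lemma continuous_on_cost:
  assumes "continuous_on UNIV f" "C-lipschitz_on S \<gamma>"
  shows "continuous_on S (\<lambda>r. f (\<gamma> r))"
  by (rule continuous_on_compose2[OF assms(1) lipschitz_on_continuous_on[OF assms(2)]]) auto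

text \<open>The curve passes from \<open>\<gamma> s\<close> to \<open>\<gamma> (s + h)\<close>, which is within distance \<open>h\<close>, so the upper slope bound
at \<open>(\<gamma> s, t - s)\<close> applies to this step and the integral of \<open>f\<close> compensates the decrease of \<open>u\<close> up
to \<open>e h\<close>.\<close>

lemma cost_along_curve_mono:
  fixes u :: "'a::metric_space \<times> real \<Rightarrow> real"
  assumes f: "continuous_on UNIV f" and u: "continuous_on (spacetime T) u"
    and slope: "\<And>x t. t \<in> {0<..<T} \<Longrightarrow> slope_upper f u x t"
    and lip: "1-lipschitz_on {0..b} \<gamma>" and ab: "0 \<le> a" "a \<le> b" and t: "b < t" "t < T"
  shows "integral {0..a} (\<lambda>r. f (\<gamma> r)) + u (\<gamma> a, t - a)
       \<le> integral {0..b} (\<lambda>r. f (\<gamma> r)) + u (\<gamma> b, t - b)"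
proof (rule field_le_epsilon)
  fix e0 :: real assume "e0 > 0"
  define e where "e = e0 / (b - a + 1)"
  have "e > 0" using \<open>e0 > 0\<close> ab by (simp add: e_def)
  have f\<gamma>: "continuous_on {0..b} (\<lambda>r. f (\<gamma> r))" by (rule continuous_on_cost[OF f lip])
  define F where "F s = integral {0..s} (\<lambda>r. f (\<gamma> r)) + u (\<gamma> s, t - s) + e * (s - a)" for s
  have "F a \<le> F b"
  proof (rule nondecreasing_if_right_step[where F = F])
    have "continuous_on {0..b} (\<lambda>s. integral {0..s} (\<lambda>r. f (\<gamma> r)))"
      by (rule indefinite_integral_continuous_1[OF integrable_continuous_interval[OF f\<gamma>]])
    moreover have "continuous_on {0..b} (\<lambda>s. u (\<gamma> s, t - s))"
      by (rule continuous_on_compose2[OF u])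
         (use t in \<open>auto intro!: continuous_intros lipschitz_on_continuous_on[OF lip]\<close>)
    ultimately have "continuous_on {0..b} F"
      unfolding F_def by (intro continuous_intros)
    then show "continuous_on {a..b} F" by (rule continuous_on_subset) (use ab in auto)
    fix s assume s: "a \<le> s" "s < b"
    have "s \<in> {0..b}" "e / 2 > 0" using s ab \<open>e > 0\<close> by auto
    then obtain d where d: "d > 0" "\<And>r. r \<in> {0..b} \<Longrightarrow> dist r s < d \<Longrightarrow> dist (f (\<gamma> r)) (f (\<gamma> s)) < e / 2"
      using f\<gamma>[unfolded continuous_on_iff, rule_format, of s "e / 2"] by blast
    have "slope_upper f u (\<gamma> s) (t - s)" using s t ab by (intro slope) auto
    then have "eventually (\<lambda>h. \<forall>y. dist (\<gamma> s) y \<le> h \<longrightarrow>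
        u (\<gamma> s, t - s) - u (y, t - s - h) \<le> (f (\<gamma> s) + e / 2) * h) (at_right 0)"
      using \<open>e > 0\<close> unfolding slope_upper_def by (meson half_gt_zero)
    moreover have "eventually (\<lambda>h. h \<in> {0<..<min d (b - s)}) (at_right 0)"
      by (rule eventually_at_right_real) (use d s in auto)
    ultimately have "eventually (\<lambda>h. (\<forall>y. dist (\<gamma> s) y \<le> h \<longrightarrow>
        u (\<gamma> s, t - s) - u (y, t - s - h) \<le> (f (\<gamma> s) + e / 2) * h) \<and> h \<in> {0<..<min d (b - s)}) (at_right 0)"
      by (rule eventually_conj)
    then obtain h where h: "\<And>y. dist (\<gamma> s) y \<le> h \<Longrightarrow>
        u (\<gamma> s, t - s) - u (y, t - s - h) \<le> (f (\<gamma> s) + e / 2) * h" "0 < h" "h < d" "h < b - s"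
      using eventually_happens'[OF trivial_limit_at_right_real[of 0]] by (force simp del: split_paired_All)
    have "dist (\<gamma> s) (\<gamma> (s + h)) \<le> 1 * dist s (s + h)"
      using h s ab by (intro lipschitz_onD[OF lip]) auto
    then have "u (\<gamma> s, t - s) - u (\<gamma> (s + h), t - s - h) \<le> (f (\<gamma> s) + e / 2) * h"
      using h by (intro h(1)) (simp add: dist_real_def)
    moreover have "integral {0..s + h} (\<lambda>r. f (\<gamma> r))
        = integral {0..s} (\<lambda>r. f (\<gamma> r)) + integral {s..s + h} (\<lambda>r. f (\<gamma> r))"
      using h s ab by (intro integral_split continuous_on_subset[OF f\<gamma>]) auto
    moreover have "(f (\<gamma> s) - e / 2) * (s + h - s) \<le> integral {s..s + h} (\<lambda>r. f (\<gamma> r))"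
    proof (rule integral_ge_const)
      show "continuous_on {s..s + h} (\<lambda>r. f (\<gamma> r))"
        by (rule continuous_on_subset[OF f\<gamma>]) (use h s ab in auto)
      fix r assume r: "s \<le> r" "r \<le> s + h"
      then have "dist (f (\<gamma> r)) (f (\<gamma> s)) < e / 2"
        using h s ab by (intro d(2)) (auto simp: dist_real_def)
      then show "f (\<gamma> s) - e / 2 \<le> f (\<gamma> r)" unfolding dist_real_def by linarith
    qed (use h in simp)
    ultimately have "F s \<le> F (s + h)" by (simp add: F_def algebra_simps)
    then show "\<exists>s'. s < s' \<and> s' \<le> b \<and> F s \<le> F s'" using h by (intro exI[of _ "s + h"]) auto
  qed fact
  moreover have "e * (b - a) \<le> e0"
  proof -
    have "e * (b - a) \<le> e * (b - a + 1)" using \<open>e > 0\<close> by simp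
    also have "\<dots> = e0" using ab by (simp add: e_def)
    finally show ?thesis .
  qed
  ultimately show "integral {0..a} (\<lambda>r. f (\<gamma> r)) + u (\<gamma> a, t - a)
       \<le> integral {0..b} (\<lambda>r. f (\<gamma> r)) + u (\<gamma> b, t - b) + e0"
    by (simp add: F_def)
qed

section \<open>Near-optimal curves\<close>

text \<open>The pairs \<open>(\<gamma>, s)\<close> of a curve and a time that satisfy the estimate with loss rate \<open>e\<close> are ordered
by extension. If the times were bounded by \<open>\<sigma>\<close>, one could choose a sequence of extensions, each
gaining at least half as much time as any other extension of the same pair. Its endpoints converge to some \<open>(x', t')\<close> with
\<open>t' > 0\<close>. The step from \<open>(x', t')\<close> to \<open>(y, t' - h)\<close> given by the equation loses only \<open>e / 4\<close> per unit
time; the remaining \<open>3 e / 4\<close> pays for starting it at a late member of the sequence, for the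
variation of \<open>f\<close> near \<open>x'\<close>, and for the extra time \<open>\<alpha>\<close> without which \<open>y\<close> might be just out
of reach. So every late member has an extension by more than \<open>h\<close>, whereas the chosen extensions
become arbitrarily short.\<close>

lemma near_optimal_curve_exists:
  fixes u :: "'a::complete_space \<times> real \<Rightarrow> real"
  assumes ls: "length_space TYPE('a)"
    and f: "continuous_on UNIV f" and u: "continuous_on (spacetime T) u"
    and slope: "\<And>x t. t \<in> {0<..<T} \<Longrightarrow> slope_lower f u x t"
    and t: "t < T" and \<sigma>: "0 \<le> \<sigma>" "\<sigma> < t" and "e > 0"
  shows "\<exists>\<gamma> s. piecewise_constant_speed \<gamma> s \<and> \<gamma> 0 = x \<and> \<sigma> \<le> s \<and> s < t \<and>
    integral {0..s} (\<lambda>r. f (\<gamma> r)) + u (\<gamma> s, t - s) \<le> u (x, t) + e * s"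
proof (rule ccontr)
  assume contra: "\<not> ?thesis"
  define P where "P p \<longleftrightarrow> piecewise_constant_speed (fst p) (snd p) \<and> fst p 0 = x \<and> 0 \<le> snd p \<and> snd p < t \<and>
    integral {0..snd p} (\<lambda>r. f (fst p r)) + u (fst p (snd p), t - snd p) \<le> u (x, t) + e * snd p"
    for p :: "(real \<Rightarrow> 'a) \<times> real"
  define E where "E p q \<longleftrightarrow> snd p \<le> snd q \<and> (\<forall>r\<le>snd p. fst q r = fst p r)"
    for p q :: "(real \<Rightarrow> 'a) \<times> real"
  have E_refl: "E p p" for p by (simp add: E_def)
  have E_trans: "E p z" if "E p q" "E q z" for p q z
    unfolding E_def
  proof (intro conjI allI impI)
    show "snd p \<le> snd z" using that order_trans unfolding E_def by blast
    fix r assume r: "r \<le> snd p"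
    then have "r \<le> snd q" using that(1) order_trans unfolding E_def by blast
    with r that show "fst z r = fst p r" unfolding E_def by metis
  qed
  have bound: "snd p \<le> \<sigma>" if "P p" for p
  proof (rule ccontr)
    assume "\<not> snd p \<le> \<sigma>"
    then have "\<sigma> \<le> snd p" by simp
    show False
      by (rule notE[OF contra], rule exI[of _ "fst p"], rule exI[of _ "snd p"])
         (use that[unfolded P_def] \<open>\<sigma> \<le> snd p\<close> in blast)
  qed
  \<comment> \<open>Extend greedily, by at least half of what is possible.\<close>
  have step: "\<exists>q. P q \<and> E p q \<and> (\<forall>q'. P q' \<and> E p q' \<longrightarrow> snd q' - snd p \<le> 2 * (snd q - snd p))"
    if p: "P p" for p
  proof -
    define A where "A = snd ` {q. P q \<and> E p q}"
    have pA: "snd p \<in> A" using p E_refl unfolding A_def by blast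
    have bdd: "bdd_above A" unfolding A_def by (rule bdd_aboveI[of _ \<sigma>]) (use bound in auto)
    have up: "snd q' \<le> Sup A" if "P q' \<and> E p q'" for q'
      by (rule cSup_upper[OF _ bdd]) (use that A_def in auto)
    show ?thesis
    proof (cases "snd p < Sup A")
      case True
      then have "(snd p + Sup A) / 2 < Sup A" by simp
      then obtain a where "a \<in> A" "(snd p + Sup A) / 2 < a"
        using less_cSupE[of "(snd p + Sup A) / 2" A] pA by blast
      then obtain q where q: "P q" "E p q" "(snd p + Sup A) / 2 < snd q" unfolding A_def by blast
      have "snd q' - snd p \<le> 2 * (snd q - snd p)" if "P q' \<and> E p q'" for q'
        using up[OF that] q(3) by simp
      with q show ?thesis by blast
    next
      case False
      have "snd q' - snd p \<le> 2 * (snd p - snd p)" if "P q' \<and> E p q'" for q'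
        using up[OF that] False by simp
      with p E_refl show ?thesis by blast
    qed
  qed
  have "P ((\<lambda>_. x), 0)"
    using \<sigma> by (simp add: P_def piecewise_constant_speed_const)
  then have "\<exists>p. \<forall>n. P (p n) \<and> (E (p n) (p (Suc n)) \<and>
      (\<forall>q'. P q' \<and> E (p n) q' \<longrightarrow> snd q' - snd (p n) \<le> 2 * (snd (p (Suc n)) - snd (p n))))"
    using step by (intro dependent_nat_choice) blast+
  then obtain p where p: "\<And>n. P (p n)" "\<And>n. E (p n) (p (Suc n))"
    and greedy: "\<And>n q'. P q' \<Longrightarrow> E (p n) q' \<Longrightarrow> snd q' - snd (p n) \<le> 2 * (snd (p (Suc n)) - snd (p n))"
    by blast
  define G S X where "G n = fst (p n)" and "S n = snd (p n)" and "X n = fst (p n) (snd (p n))" for n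
  have PG: "piecewise_constant_speed (G n) (S n)" "G n 0 = x" "0 \<le> S n" "S n < t"
    "integral {0..S n} (\<lambda>r. f (G n r)) + u (X n, t - S n) \<le> u (x, t) + e * S n" for n
    using p(1)[of n] by (auto simp: P_def G_def S_def X_def)
  have E_mono: "E (p m) (p n)" if "m \<le> n" for m n
    using that by (induction rule: dec_induct) (blast intro: E_refl E_trans p(2))+
  have S_mono: "S m \<le> S n" if "m \<le> n" for m n
    using E_mono[OF that] by (simp add: E_def S_def)
  have X_dist: "dist (X m) (X n) \<le> S n - S m" if "m \<le> n" for m n
  proof -
    have "X m = G n (S m)" using E_mono[OF that] by (simp add: E_def X_def S_def G_def)
    moreover have "dist (G n (S m)) (G n (S n)) \<le> 1 * dist (S m) (S n)"
      using PG(3) by (intro lipschitz_onD[OF piecewise_constant_speed_lipschitz[OF PG(1)]]) auto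
    ultimately show ?thesis using S_mono[OF that] by (simp add: X_def S_def G_def dist_real_def)
  qed
  have "incseq S" using S_mono by (auto simp: incseq_def)
  then obtain s where s: "S \<longlonglongrightarrow> s" and S_le: "\<And>n. S n \<le> s"
    using incseq_convergent[of S \<sigma>] bound[OF p(1)] by (auto simp: S_def)
  have "s \<le> \<sigma>" using LIMSEQ_le_const2[OF s, of \<sigma>] bound[OF p(1)] by (auto simp: S_def)
  have "Cauchy X"
  proof (rule metric_CauchyI)
    fix d :: real assume "d > 0"
    then obtain N where N: "\<And>m n. m \<ge> N \<Longrightarrow> n \<ge> N \<Longrightarrow> dist (S m) (S n) < d"
      using metric_CauchyD[OF LIMSEQ_imp_Cauchy[OF s]] by blast
    have "dist (X m) (X n) < d" if "m \<ge> N" "n \<ge> N" for m n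
      using X_dist[of m n] X_dist[of n m] N[OF that] by (cases "m \<le> n") (auto simp: dist_commute dist_real_def)
    then show "\<exists>N. \<forall>m\<ge>N. \<forall>n\<ge>N. dist (X m) (X n) < d" by blast
  qed
  then obtain x' where x': "X \<longlonglongrightarrow> x'" using Cauchy_convergent convergent_def by blast
  have X_x': "dist (X n) x' \<le> s - S n" for n
  proof (rule tendsto_le[OF sequentially_bot])
    show "(\<lambda>m. S m - S n) \<longlonglongrightarrow> s - S n" by (intro tendsto_intros s)
    show "(\<lambda>m. dist (X n) (X m)) \<longlonglongrightarrow> dist (X n) x'" by (intro tendsto_intros x')
    show "eventually (\<lambda>m. dist (X n) (X m) \<le> S m - S n) sequentially"
      using eventually_ge_at_top[of n] by eventually_elim (rule X_dist)
  qed
  define t' where "t' = t - s"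
  have t': "0 < t'" "t' < T" using \<open>s \<le> \<sigma>\<close> \<sigma> t PG(3)[of 0] S_le[of 0] by (auto simp: t'_def)
  have u_lim: "(\<lambda>n. u (X n, t - S n)) \<longlonglongrightarrow> u (x', t')"
  proof (rule continuous_on_tendsto_compose[OF u])
    show "(\<lambda>n. (X n, t - S n)) \<longlonglongrightarrow> (x', t')" unfolding t'_def by (intro tendsto_intros x' s)
    show "(x', t') \<in> spacetime T" using t' by simp
    show "eventually (\<lambda>n. (X n, t - S n) \<in> spacetime T) sequentially"
    proof (rule always_eventually, rule allI)
      show "(X n, t - S n) \<in> spacetime T" for n using PG(3)[of n] PG(4)[of n] t by simp
    qed
  qed
  \<comment> \<open>One step of the equation, taken from the limit point.\<close>
  obtain \<eta> where \<eta>: "\<eta> > 0" "\<And>z. dist z x' < \<eta> \<Longrightarrow> dist (f z) (f x') < e / 4"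
    using f[unfolded continuous_on_iff, rule_format, of x' "e / 4"] \<open>e > 0\<close> by auto
  have "frequently (\<lambda>h. \<exists>y. dist x' y \<le> h \<and> (f x' - e / 4) * h \<le> u (x', t') - u (y, t' - h)) (at_right 0)"
    using slope[of t' x'] t' \<open>e > 0\<close> unfolding slope_lower_def by simp
  moreover have "eventually (\<lambda>h. h \<in> {0<..<min (\<eta> / 3) t'}) (at_right 0)"
    by (rule eventually_at_right_real) (use \<eta> t' in auto)
  ultimately have "frequently (\<lambda>h. h \<in> {0<..<min (\<eta> / 3) t'} \<and>
      (\<exists>y. dist x' y \<le> h \<and> (f x' - e / 4) * h \<le> u (x', t') - u (y, t' - h))) (at_right 0)"
    by (rule frequently_eventually_conj)
  then obtain h y where hy: "dist x' y \<le> h" "(f x' - e / 4) * h \<le> u (x', t') - u (y, t' - h)"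
    and "h \<in> {0<..<min (\<eta> / 3) t'}"
    using frequently_ex by blast
  then have h: "0 < h" "3 * h < \<eta>" "h < t'" by auto
  \<comment> \<open>\<open>\<beta>\<close> bounds the extra time of the step when it starts from a late member of the sequence; the
    second term keeps \<open>f x' * \<beta>\<close> below \<open>e * h / 4\<close>.\<close>
  define \<beta> where "\<beta> = min h (e * h / (4 * (\<bar>f x'\<bar> + 1)))"
  have \<beta>: "\<beta> > 0" "\<beta> \<le> h" using h \<open>e > 0\<close> by (auto simp: \<beta>_def)
  have f\<beta>: "\<bar>f x'\<bar> * \<beta> \<le> e * h / 4"
  proof -
    have "\<bar>f x'\<bar> * \<beta> \<le> (\<bar>f x'\<bar> + 1) * (e * h / (4 * (\<bar>f x'\<bar> + 1)))"
      using \<beta> by (intro mult_mono) (auto simp: \<beta>_def)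
    also have "\<dots> = e * h / 4" by (simp add: field_simps)
    finally show ?thesis .
  qed
  have "((\<lambda>a. u (y, t' - h - a)) \<longlongrightarrow> u (y, t' - h - 0)) (at_right 0)"
  proof (rule continuous_on_tendsto_compose[OF u])
    show "((\<lambda>a. (y, t' - h - a)) \<longlongrightarrow> (y, t' - h - 0)) (at_right 0)" by (intro tendsto_intros)
    show "(y, t' - h - 0) \<in> spacetime T" using h t' by simp
    have "eventually (\<lambda>a. a \<in> {0<..<t' - h}) (at_right 0)"
      by (rule eventually_at_right_real) (use h in auto)
    then show "eventually (\<lambda>a. (y, t' - h - a) \<in> spacetime T) (at_right 0)"
      by eventually_elim (use h t' in auto)
  qed
  then have "eventually (\<lambda>a. u (y, t' - h - a) < u (y, t' - h) + e * h / 8) (at_right 0)"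
    using h \<open>e > 0\<close> by (intro order_tendstoD) auto
  moreover have "eventually (\<lambda>a. a \<in> {0<..<min (\<beta> / 2) (t' - h)}) (at_right 0)"
    by (rule eventually_at_right_real) (use h \<beta> in auto)
  ultimately have "eventually (\<lambda>a. u (y, t' - h - a) < u (y, t' - h) + e * h / 8 \<and>
      a \<in> {0<..<min (\<beta> / 2) (t' - h)}) (at_right 0)"
    by (rule eventually_conj)
  then obtain \<alpha> where \<alpha>_u: "u (y, t' - h - \<alpha>) < u (y, t' - h) + e * h / 8"
      and "\<alpha> \<in> {0<..<min (\<beta> / 2) (t' - h)}"
    using eventually_happens'[OF trivial_limit_at_right_real] by blast
  then have \<alpha>: "0 < \<alpha>" "\<alpha> < \<beta> / 2" "\<alpha> < t' - h" by auto
  have "eventually (\<lambda>n. s - \<beta> / 2 < S n) sequentially"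
    using s \<beta> by (intro order_tendstoD) auto
  moreover have "eventually (\<lambda>n. u (x', t') - e * h / 8 < u (X n, t - S n)) sequentially"
    using u_lim h \<open>e > 0\<close> by (intro order_tendstoD) auto
  moreover have "eventually (\<lambda>n. S (Suc n) - S n < h / 2) sequentially"
  proof -
    have "(\<lambda>n. S (Suc n) - S n) \<longlonglongrightarrow> s - s" by (intro tendsto_diff LIMSEQ_Suc s)
    then show ?thesis using h by (intro order_tendstoD) auto
  qed
  ultimately have "eventually (\<lambda>n. s - \<beta> / 2 < S n \<and> u (x', t') - e * h / 8 < u (X n, t - S n) \<and>
      S (Suc n) - S n < h / 2) sequentially"
    by eventually_elim blast
  then obtain n where n: "s - \<beta> / 2 < S n" "u (x', t') - e * h / 8 < u (X n, t - S n)"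
      "S (Suc n) - S n < h / 2"
    using eventually_happens'[OF sequentially_bot] by blast
  \<comment> \<open>Go straight to \<open>y\<close>, arriving at time \<open>s'\<close>; the time needed beyond \<open>h\<close> is \<open>b\<close>.\<close>
  define s' where "s' = s + h + \<alpha>"
  define b where "b = s' - S n - h"
  have b: "0 < b" "b \<le> \<beta>" using n(1) \<alpha> S_le[of n] by (auto simp: b_def s'_def)
  have Xn: "X n = G n (S n)" by (simp add: X_def G_def S_def)
  have s': "S n < s'" using b h by (simp add: b_def)
  have "dist (G n (S n)) y < s' - S n"
    using dist_triangle[of "X n" y x'] X_x'[of n] hy(1) \<alpha>(1) by (simp add: s'_def Xn)
  then obtain \<gamma> where \<gamma>: "piecewise_constant_speed \<gamma> s'" "\<And>r. r \<le> S n \<Longrightarrow> \<gamma> r = G n r" "\<gamma> s' = y"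
    using piecewise_constant_speed_extend[OF ls PG(1)[of n] PG(3)[of n] s'] by blast
  have lip: "1-lipschitz_on {0..} \<gamma>" using \<gamma>(1) by (rule piecewise_constant_speed_lipschitz)
  have f\<gamma>: "continuous_on {0..s'} (\<lambda>r. f (\<gamma> r))"
    by (rule continuous_on_cost[OF f lipschitz_on_subset[OF lip]]) auto
  have "integral {0..s'} (\<lambda>r. f (\<gamma> r)) = integral {0..S n} (\<lambda>r. f (\<gamma> r)) + integral {S n..s'} (\<lambda>r. f (\<gamma> r))"
    using PG(3)[of n] s' by (intro integral_split f\<gamma>) auto
  also have "integral {0..S n} (\<lambda>r. f (\<gamma> r)) = integral {0..S n} (\<lambda>r. f (G n r))"
    by (rule integral_cong) (simp add: \<gamma>(2))
  also have "integral {S n..s'} (\<lambda>r. f (\<gamma> r)) \<le> (f x' + e / 4) * (s' - S n)"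
  proof (rule integral_le_const)
    show "continuous_on {S n..s'} (\<lambda>r. f (\<gamma> r))"
      by (rule continuous_on_subset[OF f\<gamma>]) (use PG(3)[of n] in auto)
    fix r assume r: "S n \<le> r" "r \<le> s'"
    have "dist (\<gamma> r) (\<gamma> (S n)) \<le> 1 * dist r (S n)"
      using PG(3)[of n] r by (intro lipschitz_onD[OF lip]) auto
    then have "dist (\<gamma> r) x' \<le> (s' - S n) + (s - S n)"
      using dist_triangle[of "\<gamma> r" x' "\<gamma> (S n)"] X_x'[of n] r by (simp add: \<gamma>(2) Xn dist_real_def)
    also have "\<dots> < \<eta>" using n(1) b h \<beta> by (simp add: b_def)
    finally have "dist (f (\<gamma> r)) (f x') < e / 4" by (rule \<eta>(2))
    then show "f (\<gamma> r) \<le> f x' + e / 4" unfolding dist_real_def by linarith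
  qed (use s' in simp)
  finally have int: "integral {0..s'} (\<lambda>r. f (\<gamma> r))
      \<le> integral {0..S n} (\<lambda>r. f (G n r)) + (f x' + e / 4) * (s' - S n)" by simp
  have "u (y, t - s') < u (y, t' - h) + e * h / 8"
    using \<alpha>_u by (simp add: s'_def t'_def algebra_simps)
  moreover have "f x' * b \<le> e * h / 4"
  proof -
    have "f x' * b \<le> \<bar>f x'\<bar> * \<beta>" using b by (intro mult_mono) auto
    with f\<beta> show ?thesis by simp
  qed
  moreover have "0 < e * b" using b \<open>e > 0\<close> by simp
  moreover have "s' - S n = h + b" "s' = S n + h + b" by (simp_all add: b_def)
  then have "(f x' + e / 4) * (s' - S n) = f x' * h + f x' * b + e * h / 4 + e * b / 4"
    and "e * s' = e * S n + e * h + e * b"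
    by (simp_all add: distrib_left distrib_right)
  moreover have "(f x' - e / 4) * h = f x' * h - e * h / 4" by (simp add: left_diff_distrib)
  ultimately have "integral {0..s'} (\<lambda>r. f (\<gamma> r)) + u (y, t - s') \<le> u (x, t) + e * s'"
    using int hy(2) n(2) PG(5)[of n] by linarith
  moreover have "s' < t" using \<alpha>(3) by (simp add: s'_def t'_def)
  ultimately have "P (\<gamma>, s')"
    using \<gamma> PG(2)[of n] PG(3)[of n] s' by (simp add: P_def)
  moreover have "E (p n) (\<gamma>, s')"
    using \<gamma>(2) s' by (simp add: E_def S_def G_def)
  ultimately have "s' - S n \<le> 2 * (S (Suc n) - S n)"
    using greedy[of "(\<gamma>, s')" n] by (simp add: S_def)
  with n(3) b(1) show False by (simp add: b_def)
qed

section \<open>Monge solutions are curve-based solutions\<close>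

lemma arcwise_continuousI:
  assumes "continuous_on (spacetime T) u"
  shows "arcwise_continuous T u"
  unfolding arcwise_continuous_def
proof (intro allI impI)
  fix \<gamma> :: "real \<Rightarrow> 'a" assume "abs_cont_curve_on UNIV \<gamma>"
  then have "continuous_on UNIV \<gamma>" by (rule abs_cont_curve_continuous)
  have "continuous_on (UNIV \<times> {0<..<T}) (\<lambda>p. (\<gamma> (fst p), snd p))"
    by (intro continuous_on_Pair continuous_on_snd continuous_on_id
        continuous_on_compose2[OF \<open>continuous_on UNIV \<gamma>\<close> continuous_on_fst] subset_UNIV)
  then have "continuous_on (UNIV \<times> {0<..<T}) (\<lambda>p. u (\<gamma> (fst p), snd p))"
    by (rule continuous_on_compose2[OF assms]) auto
  then show "continuous_on (UNIV \<times> {0<..<T}) (\<lambda>(s, t). u (\<gamma> s, t))"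
    by (simp add: case_prod_unfold)
qed

lemma curve_based_subsolutionI:
  fixes u :: "'a::metric_space \<times> real \<Rightarrow> real"
  assumes f: "continuous_on UNIV f" and M: "\<And>x. \<bar>f x\<bar> \<le> M" and u: "continuous_on (spacetime T) u"
    and slope: "\<And>x t. t \<in> {0<..<T} \<Longrightarrow> slope_upper f u x t"
  shows "curve_based_subsolution f T u"
  unfolding curve_based_subsolution_def
proof (intro conjI allI ballI arcwise_continuousI[OF u])
  fix x t \<gamma> \<delta> assume t: "t \<in> {0<..<T}" and \<gamma>: "\<gamma> \<in> admissible_curves f x" and \<delta>: "\<delta> \<in> {0..<t}"
  show "ereal (u (x, t)) \<le> action f \<gamma> \<delta> + ereal (u (\<gamma> \<delta>, t - \<delta>))"
  proof (cases "action f \<gamma> \<delta> = \<infinity>")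
    case False
    have lip: "1-lipschitz_on {0..\<delta>} \<gamma>" by (rule finite_action_imp_lipschitz[OF f M \<gamma> False])
    have "\<gamma> 0 = x" using \<gamma> by (simp add: admissible_curves_def)
    with cost_along_curve_mono[OF f u slope lip, of 0 t] t \<delta>
    show ?thesis by (simp add: action_lipschitz_curve[OF f \<gamma> lip])
  qed simp
qed

text \<open>The final time \<open>s\<close> of the near-optimal curve is chosen so late that \<open>u\<close> is within \<open>\<epsilon> / 4\<close> of \<open>u0\<close>
afterwards and that waiting until time \<open>t\<close> costs at most \<open>\<epsilon> / 4\<close>.\<close>

lemma curve_based_supersolutionI:
  fixes u :: "'a::complete_space \<times> real \<Rightarrow> real"
  assumes ls: "length_space TYPE('a)"
    and f: "continuous_on UNIV f" and M: "\<And>x. \<bar>f x\<bar> \<le> M" and u: "continuous_on (spacetime T) u"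
    and slope: "\<And>x t. t \<in> {0<..<T} \<Longrightarrow> slope_upper f u x t" "\<And>x t. t \<in> {0<..<T} \<Longrightarrow> slope_lower f u x t"
    and init: "\<And>e. e > 0 \<Longrightarrow> \<exists>\<tau>>0. \<forall>r y. 0 < r \<and> r < \<tau> \<longrightarrow> \<bar>u (y, r) - u0 y\<bar> \<le> e"
  shows "curve_based_supersolution f T u"
  unfolding curve_based_supersolution_def
proof (intro conjI allI ballI impI arcwise_continuousI[OF u])
  fix x t \<epsilon> assume t: "t \<in> {0<..<T}" and "(\<epsilon>::real) > 0"
  have "M \<ge> 0" using M[of x] by simp
  obtain \<tau> where \<tau>: "\<tau> > 0" "\<forall>r y. 0 < r \<and> r < \<tau> \<longrightarrow> \<bar>u (y, r) - u0 y\<bar> \<le> \<epsilon> / 4"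
    using init[of "\<epsilon> / 4"] \<open>\<epsilon> > 0\<close> by auto
  define \<mu> where "\<mu> = min t (min \<tau> (\<epsilon> / (4 * (M + 1))))"
  have "\<epsilon> / (4 * (M + 1)) > 0" using \<open>\<epsilon> > 0\<close> \<open>M \<ge> 0\<close> by simp
  then have \<mu>: "0 < \<mu>" "\<mu> \<le> t" "\<mu> \<le> \<tau>" "\<mu> \<le> \<epsilon> / (4 * (M + 1))"
    using \<tau>(1) t unfolding \<mu>_def by auto
  define \<tau>' where "\<tau>' = \<mu> / 2"
  have \<tau>': "0 < \<tau>'" "\<tau>' < t" "\<tau>' < \<tau>" "\<tau>' \<le> \<epsilon> / (4 * (M + 1))"
    unfolding \<tau>'_def using \<mu> by linarith+
  have M\<tau>': "M * \<tau>' \<le> \<epsilon> / 4"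
  proof -
    have "M * \<tau>' \<le> (M + 1) * (\<epsilon> / (4 * (M + 1)))"
      using \<open>M \<ge> 0\<close> \<tau>'(1,4) by (intro mult_mono) auto
    also have "\<dots> = \<epsilon> / 4" using \<open>M \<ge> 0\<close> by (simp add: field_simps)
    finally show ?thesis .
  qed
  \<comment> \<open>The loss accumulated up to any time before \<open>t\<close> is at most \<open>\<epsilon> / 4\<close>.\<close>
  define e where "e = \<epsilon> / (4 * t)"
  have "e > 0" using t \<open>\<epsilon> > 0\<close> by (simp add: e_def)
  have "\<exists>\<gamma> s. piecewise_constant_speed \<gamma> s \<and> \<gamma> 0 = x \<and> t - \<tau>' \<le> s \<and> s < t \<and>
      integral {0..s} (\<lambda>r. f (\<gamma> r)) + u (\<gamma> s, t - s) \<le> u (x, t) + e * s"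
    using t \<tau>' \<open>e > 0\<close> by (intro near_optimal_curve_exists[OF ls f u slope(2)]) auto
  then obtain \<gamma> s where \<gamma>: "piecewise_constant_speed \<gamma> s" "\<gamma> 0 = x" and s: "t - \<tau>' \<le> s" "s < t"
    and opt: "integral {0..s} (\<lambda>r. f (\<gamma> r)) + u (\<gamma> s, t - s) \<le> u (x, t) + e * s" by blast
  have "0 \<le> s" using s \<tau>' by simp
  have "e * s \<le> \<epsilon> / 4"
  proof -
    have "e * s \<le> e * t" using s \<open>e > 0\<close> by simp
    also have "\<dots> = \<epsilon> / 4" using t by (simp add: e_def)
    finally show ?thesis .
  qed
  have \<gamma>_adm: "\<gamma> \<in> admissible_curves f x"
    using piecewise_constant_speed_admissible[OF f \<gamma>(1) \<open>0 \<le> s\<close>] \<gamma>(2) by simp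
  have lip: "1-lipschitz_on {0..b} \<gamma>" for b
    by (rule lipschitz_on_subset[OF piecewise_constant_speed_lipschitz[OF \<gamma>(1)]]) auto
  have "ereal (u (x, t)) \<ge> action f \<gamma> \<delta> + ereal (u (\<gamma> \<delta>, t - \<delta>)) - ereal \<epsilon>" if \<delta>: "\<delta> \<in> {0..<t}" for \<delta>
  proof -
    have "integral {0..\<delta>} (\<lambda>r. f (\<gamma> r)) + u (\<gamma> \<delta>, t - \<delta>) \<le> u (x, t) + \<epsilon>"
    proof (cases "\<delta> \<le> s")
      case True
      then have "integral {0..\<delta>} (\<lambda>r. f (\<gamma> r)) + u (\<gamma> \<delta>, t - \<delta>)
          \<le> integral {0..s} (\<lambda>r. f (\<gamma> r)) + u (\<gamma> s, t - s)"
        using \<delta> t s by (intro cost_along_curve_mono[OF f u slope(1) lip]) auto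
      with opt \<open>e * s \<le> \<epsilon> / 4\<close> \<open>\<epsilon> > 0\<close> show ?thesis by linarith
    next
      case False
      have "\<gamma> \<delta> = \<gamma> s" using False by (intro piecewise_constant_speed_after[OF \<gamma>(1)]) simp
      have "\<bar>u (\<gamma> s, t - \<delta>) - u0 (\<gamma> s)\<bar> \<le> \<epsilon> / 4" "\<bar>u (\<gamma> s, t - s) - u0 (\<gamma> s)\<bar> \<le> \<epsilon> / 4"
        using \<tau>(2) \<delta> s False \<tau>' by auto
      moreover have "integral {0..\<delta>} (\<lambda>r. f (\<gamma> r)) = integral {0..s} (\<lambda>r. f (\<gamma> r)) + integral {s..\<delta>} (\<lambda>r. f (\<gamma> r))"
        using \<open>0 \<le> s\<close> False by (intro integral_split continuous_on_cost[OF f lip]) auto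
      moreover have "integral {s..\<delta>} (\<lambda>r. f (\<gamma> r)) \<le> M * (\<delta> - s)"
      proof (rule integral_le_const)
        show "continuous_on {s..\<delta>} (\<lambda>r. f (\<gamma> r))"
          by (rule continuous_on_subset[OF continuous_on_cost[OF f lip[of \<delta>]]]) (use \<open>0 \<le> s\<close> in auto)
        show "f (\<gamma> r) \<le> M" for r using M[of "\<gamma> r"] by simp
      qed (use False in simp)
      moreover have "M * (\<delta> - s) \<le> M * \<tau>'"
        using s \<delta> \<open>M \<ge> 0\<close> by (intro mult_left_mono) auto
      ultimately show ?thesis
        using opt \<open>e * s \<le> \<epsilon> / 4\<close> M\<tau>' unfolding \<open>\<gamma> \<delta> = \<gamma> s\<close> by linarith
    qed
    then show ?thesis by (simp add: action_lipschitz_curve[OF f \<gamma>_adm lip])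
  qed
  then show "\<exists>\<gamma>\<in>admissible_curves f x. \<forall>\<delta>\<in>{0..<t}.
        ereal (u (x, t)) \<ge> action f \<gamma> \<delta> + ereal (u (\<gamma> \<delta>, t - \<delta>)) - ereal \<epsilon>"
    using \<gamma>_adm by blast
qed

section \<open>Curve-based solutions are Monge solutions\<close>

lemma curve_based_subsolutionD:
  assumes "curve_based_subsolution f T u" and f: "continuous_on UNIV f"
    and \<gamma>: "\<gamma> \<in> admissible_curves f x" and lip: "1-lipschitz_on {0..\<delta>} \<gamma>"
    and "0 < t" "t < T" "0 \<le> \<delta>" "\<delta> < t"
  shows "u (x, t) \<le> integral {0..\<delta>} (\<lambda>r. f (\<gamma> r)) + u (\<gamma> \<delta>, t - \<delta>)"
proof -
  have "ereal (u (x, t)) \<le> action f \<gamma> \<delta> + ereal (u (\<gamma> \<delta>, t - \<delta>))"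
    using assms unfolding curve_based_subsolution_def by auto
  then show ?thesis by (simp add: action_lipschitz_curve[OF f \<gamma> lip])
qed

lemma curve_based_supersolutionD:
  assumes super: "curve_based_supersolution f T u"
    and f: "continuous_on UNIV f" and M: "\<And>x. \<bar>f x\<bar> \<le> M" and t: "0 < t" "t < T" and "\<epsilon> > 0"
  obtains \<gamma> where "\<gamma> \<in> admissible_curves f x" "\<And>\<delta>. \<delta> < t \<Longrightarrow> 1-lipschitz_on {0..\<delta>} \<gamma>"
    "\<And>\<delta>. 0 \<le> \<delta> \<Longrightarrow> \<delta> < t \<Longrightarrow> integral {0..\<delta>} (\<lambda>r. f (\<gamma> r)) + u (\<gamma> \<delta>, t - \<delta>) \<le> u (x, t) + \<epsilon>"
proof -
  obtain \<gamma> where \<gamma>: "\<gamma> \<in> admissible_curves f x"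
    and opt: "\<forall>\<delta>\<in>{0..<t}. ereal (u (x, t)) \<ge> action f \<gamma> \<delta> + ereal (u (\<gamma> \<delta>, t - \<delta>)) - ereal \<epsilon>"
    using super t \<open>\<epsilon> > 0\<close> unfolding curve_based_supersolution_def by force
  have opt': "action f \<gamma> \<delta> + ereal (u (\<gamma> \<delta>, t - \<delta>)) - ereal \<epsilon> \<le> ereal (u (x, t))"
    if "0 \<le> \<delta>" "\<delta> < t" for \<delta>
    using opt that by simp
  have lip: "1-lipschitz_on {0..\<delta>} \<gamma>" if "\<delta> < t" for \<delta>
  proof (cases "0 \<le> \<delta>")
    case True
    then have "action f \<gamma> \<delta> \<noteq> \<infinity>" using opt'[OF True that] by auto
    then show ?thesis by (rule finite_action_imp_lipschitz[OF f M \<gamma>])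
  qed (auto intro!: lipschitz_onI)
  have "integral {0..\<delta>} (\<lambda>r. f (\<gamma> r)) + u (\<gamma> \<delta>, t - \<delta>) \<le> u (x, t) + \<epsilon>" if "0 \<le> \<delta>" "\<delta> < t" for \<delta>
    using opt'[OF that] by (simp add: action_lipschitz_curve[OF f \<gamma> lip[OF that(2)]])
  with \<gamma> lip show ?thesis by (rule that)
qed

text \<open>A curve of speed at most one from \<open>x\<close> to \<open>y\<close> need not exist for time \<open>h\<close> when \<open>dist x y = h\<close>,
because there may be no shortest path. It does exist for every longer time \<open>h + a\<close>, and
continuity of \<open>u\<close> in time allows \<open>a\<close> to tend to \<open>0\<close>.\<close>

lemma subsolution_jump:
  fixes u :: "'a::metric_space \<times> real \<Rightarrow> real"
  assumes ls: "length_space TYPE('a)" and sub: "curve_based_subsolution f T u"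
    and f: "continuous_on UNIV f" and u: "continuous_on (spacetime T) u"
    and t: "t < T" and h: "0 < h" "h < t" and y: "dist x y \<le> h"
    and B: "\<And>z. dist x z < \<eta> \<Longrightarrow> f z \<le> B" and "h < \<eta>"
  shows "u (x, t) - u (y, t - h) \<le> B * h"
proof -
  have bound: "u (x, t) \<le> B * (h + a) + u (y, t - h - a)" if a: "0 < a" "h + a < t" "h + a < \<eta>" for a
  proof -
    obtain \<gamma> where \<gamma>: "piecewise_constant_speed \<gamma> (h + a)" "\<And>s. s \<le> 0 \<Longrightarrow> \<gamma> s = x" "\<gamma> (h + a) = y"
      by (rule piecewise_constant_speed_extend[OF ls piecewise_constant_speed_const[of x], of "h + a" y])
         (use a h y in auto)
    have lip: "1-lipschitz_on {0..b} \<gamma>" for b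
      by (rule lipschitz_on_subset[OF piecewise_constant_speed_lipschitz[OF \<gamma>(1)]]) auto
    have "\<gamma> \<in> admissible_curves f x"
      using piecewise_constant_speed_admissible[OF f \<gamma>(1)] \<gamma>(2)[of 0] a h by simp
    then have "u (x, t) \<le> integral {0..h + a} (\<lambda>r. f (\<gamma> r)) + u (\<gamma> (h + a), t - (h + a))"
      using t a h by (intro curve_based_subsolutionD[OF sub f _ lip]) auto
    also have "integral {0..h + a} (\<lambda>r. f (\<gamma> r)) \<le> B * (h + a - 0)"
    proof (rule integral_le_const[OF continuous_on_cost[OF f lip]])
      fix r assume r: "0 \<le> r" "r \<le> h + a"
      have "dist (\<gamma> 0) (\<gamma> r) \<le> 1 * dist 0 r"
        using r by (intro lipschitz_onD[OF lip[of "h + a"]]) auto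
      then have "dist x (\<gamma> r) < \<eta>" using \<gamma>(2)[of 0] r a by simp
      then show "f (\<gamma> r) \<le> B" by (rule B)
    qed (use a h in simp)
    finally show ?thesis by (simp add: \<gamma>(3) diff_diff_eq)
  qed
  have "u (x, t) \<le> B * (h + 0) + u (y, t - h - 0)"
  proof (rule tendsto_lowerbound[OF _ _ trivial_limit_at_right_real])
    have "((\<lambda>a. u (y, t - h - a)) \<longlongrightarrow> u (y, t - h - 0)) (at_right 0)"
    proof (rule continuous_on_tendsto_compose[OF u])
      show "((\<lambda>a. (y, t - h - a)) \<longlongrightarrow> (y, t - h - 0)) (at_right 0)" by (intro tendsto_intros)
      show "(y, t - h - 0) \<in> spacetime T" using h t by simp
      have "eventually (\<lambda>a. a \<in> {0<..<t - h}) (at_right 0)"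
        by (rule eventually_at_right_real) (use h in auto)
      then show "eventually (\<lambda>a. (y, t - h - a) \<in> spacetime T) (at_right 0)"
        by eventually_elim (use h t in auto)
    qed
    then show "((\<lambda>a. B * (h + a) + u (y, t - h - a)) \<longlongrightarrow> B * (h + 0) + u (y, t - h - 0)) (at_right 0)"
      by (intro tendsto_intros)
    have "eventually (\<lambda>a. a \<in> {0<..<min (t - h) (\<eta> - h)}) (at_right 0)"
      by (rule eventually_at_right_real) (use h \<open>h < \<eta>\<close> in auto)
    then show "eventually (\<lambda>a. u (x, t) \<le> B * (h + a) + u (y, t - h - a)) (at_right 0)"
    proof eventually_elim
      case (elim a)
      then show ?case by (intro bound) auto
    qed
  qed
  then show ?thesis by simp
qed

lemma slope_upper_if_subsolution:
  fixes u :: "'a::metric_space \<times> real \<Rightarrow> real"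
  assumes ls: "length_space TYPE('a)" and sub: "curve_based_subsolution f T u"
    and f: "continuous_on UNIV f" and u: "continuous_on (spacetime T) u" and t: "0 < t" "t < T"
  shows "slope_upper f u x t"
  unfolding slope_upper_def
proof (intro allI impI)
  fix e :: real assume "e > 0"
  then obtain \<eta> where \<eta>: "\<eta> > 0" "\<And>z. dist z x < \<eta> \<Longrightarrow> dist (f z) (f x) < e"
    using f[unfolded continuous_on_iff, rule_format, of x e] by auto
  have B: "f z \<le> f x + e" if "dist x z < \<eta>" for z
    using \<eta>(2)[of z] that unfolding dist_real_def dist_commute[of z x] by linarith
  have "eventually (\<lambda>\<delta>. \<delta> \<in> {0<..<min \<eta> t}) (at_right 0)"
    by (rule eventually_at_right_real) (use \<eta> t in auto)
  then show "eventually (\<lambda>\<delta>. \<forall>y. dist x y \<le> \<delta> \<longrightarrow> u (x, t) - u (y, t - \<delta>) \<le> (f x + e) * \<delta>) (at_right 0)"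
  proof eventually_elim
    case (elim \<delta>)
    show ?case
    proof (intro allI impI)
      fix y assume "dist x y \<le> \<delta>"
      with elim show "u (x, t) - u (y, t - \<delta>) \<le> (f x + e) * \<delta>"
        by (intro subsolution_jump[OF ls sub f u \<open>t < T\<close> _ _ _ B]) auto
    qed
  qed
qed

text \<open>The admissible error is at our disposal, so it can be taken proportional to the time step.\<close>

lemma slope_lower_if_supersolution:
  fixes u :: "'a::metric_space \<times> real \<Rightarrow> real"
  assumes super: "curve_based_supersolution f T u"
    and f: "continuous_on UNIV f" and M: "\<And>x. \<bar>f x\<bar> \<le> M" and t: "0 < t" "t < T"
  shows "slope_lower f u x t"
  unfolding slope_lower_def
proof (intro allI impI)
  fix e :: real assume "e > 0"
  then obtain \<eta> where \<eta>: "\<eta> > 0" "\<And>z. dist z x < \<eta> \<Longrightarrow> dist (f z) (f x) < e / 2"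
    using f[unfolded continuous_on_iff, rule_format, of x "e / 2"] by auto
  have "eventually (\<lambda>\<delta>. \<delta> \<in> {0<..<min \<eta> t}) (at_right 0)"
    by (rule eventually_at_right_real) (use \<eta> t in auto)
  then have "eventually (\<lambda>\<delta>. \<exists>y. dist x y \<le> \<delta> \<and> (f x - e) * \<delta> \<le> u (x, t) - u (y, t - \<delta>)) (at_right 0)"
  proof eventually_elim
    case (elim \<delta>)
    then have \<delta>: "0 < \<delta>" "\<delta> < \<eta>" "\<delta> < t" by auto
    then have "e * \<delta> / 2 > 0" using \<open>e > 0\<close> by simp
    obtain \<gamma> where \<gamma>: "\<gamma> \<in> admissible_curves f x" and lip: "\<And>\<delta>. \<delta> < t \<Longrightarrow> 1-lipschitz_on {0..\<delta>} \<gamma>"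
      and opt: "\<And>r. 0 \<le> r \<Longrightarrow> r < t \<Longrightarrow>
        integral {0..r} (\<lambda>r. f (\<gamma> r)) + u (\<gamma> r, t - r) \<le> u (x, t) + e * \<delta> / 2"
      by (rule curve_based_supersolutionD[OF super f M t \<open>e * \<delta> / 2 > 0\<close>, of x], rule that)
    have \<gamma>0: "\<gamma> 0 = x" using \<gamma> by (simp add: admissible_curves_def)
    have lip': "1-lipschitz_on {0..\<delta>} \<gamma>" using \<delta> by (intro lip)
    have near: "dist x (\<gamma> r) \<le> r" if "0 \<le> r" "r \<le> \<delta>" for r
      using lipschitz_onD[OF lip', of 0 r] that \<delta> by (simp add: \<gamma>0)
    have "(f x - e / 2) * (\<delta> - 0) \<le> integral {0..\<delta>} (\<lambda>r. f (\<gamma> r))"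
    proof (rule integral_ge_const[OF continuous_on_cost[OF f lip']])
      fix r assume "0 \<le> r" "r \<le> \<delta>"
      then have "dist (\<gamma> r) x < \<eta>" using near[of r] \<delta> by (simp add: dist_commute)
      then have "dist (f (\<gamma> r)) (f x) < e / 2" by (rule \<eta>(2))
      then show "f x - e / 2 \<le> f (\<gamma> r)" unfolding dist_real_def by linarith
    qed (use \<delta> in simp)
    then have "(f x - e) * \<delta> \<le> u (x, t) - u (\<gamma> \<delta>, t - \<delta>)"
      using opt[of \<delta>] \<delta> by (simp add: algebra_simps)
    with near[of \<delta>] \<delta> show ?case by (intro exI[of _ "\<gamma> \<delta>"]) simp
  qed
  then show "frequently (\<lambda>\<delta>. \<exists>y. dist x y \<le> \<delta> \<and> (f x - e) * \<delta> \<le> u (x, t) - u (y, t - \<delta>)) (at_right 0)"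
    by (intro eventually_frequently) auto
qed

text \<open>Let \<open>r\<close> be a small remaining time. A near-optimal curve for \<open>(x, t)\<close> has reached \<open>\<gamma> (t - r)\<close>, and as
a competitor for \<open>(x, s)\<close> it has reached \<open>\<gamma> (s - r)\<close>. The two costs differ by an integral of \<open>f\<close>
over a time interval of length \<open>t - s\<close> and by values of \<open>u\<close> at time \<open>r\<close>, where \<open>u\<close> is almost \<open>u0\<close>.\<close>

lemma time_derivative_bound:
  fixes u :: "'a::metric_space \<times> real \<Rightarrow> real"
  assumes sub: "curve_based_subsolution f T u" and super: "curve_based_supersolution f T u"
    and f: "continuous_on UNIV f" and M: "\<And>x. \<bar>f x\<bar> \<le> M" and u0: "C-lipschitz_on UNIV u0"
    and init: "\<And>e. e > 0 \<Longrightarrow> \<exists>\<tau>>0. \<forall>r y. 0 < r \<and> r < \<tau> \<longrightarrow> \<bar>u (y, r) - u0 y\<bar> \<le> e"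
    and st: "0 < s" "s < t" "t < T"
  shows "- (M + C) * (t - s) \<le> u (x, t) - u (x, s)"
proof (rule field_le_epsilon)
  fix e :: real assume "e > 0"
  obtain \<tau> where \<tau>: "\<tau> > 0" "\<forall>r y. 0 < r \<and> r < \<tau> \<longrightarrow> \<bar>u (y, r) - u0 y\<bar> \<le> e / 3"
    using init[of "e / 3"] \<open>e > 0\<close> by auto
  define r where "r = min \<tau> s / 2"
  have r: "0 < r" "r < \<tau>" "r < s" using \<tau>(1) st by (auto simp: r_def min_def)
  have "0 < t" "e / 3 > 0" using st \<open>e > 0\<close> by auto
  obtain \<gamma> where \<gamma>: "\<gamma> \<in> admissible_curves f x" and lip: "\<And>\<delta>. \<delta> < t \<Longrightarrow> 1-lipschitz_on {0..\<delta>} \<gamma>"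
    and opt: "\<And>\<delta>. 0 \<le> \<delta> \<Longrightarrow> \<delta> < t \<Longrightarrow>
      integral {0..\<delta>} (\<lambda>r. f (\<gamma> r)) + u (\<gamma> \<delta>, t - \<delta>) \<le> u (x, t) + e / 3"
    by (rule curve_based_supersolutionD[OF super f M \<open>0 < t\<close> \<open>t < T\<close> \<open>e / 3 > 0\<close>, of x], rule that)
  have lip': "1-lipschitz_on {0..t - r} \<gamma>" using r by (intro lip) simp
  have f\<gamma>: "continuous_on {0..t - r} (\<lambda>r. f (\<gamma> r))" by (rule continuous_on_cost[OF f lip'])
  have "u (x, s) \<le> integral {0..s - r} (\<lambda>r. f (\<gamma> r)) + u (\<gamma> (s - r), r)"
    using curve_based_subsolutionD[OF sub f \<gamma> lip[of "s - r"], of s] r st by simp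
  moreover have "integral {0..t - r} (\<lambda>r. f (\<gamma> r)) + u (\<gamma> (t - r), r) \<le> u (x, t) + e / 3"
    using opt[of "t - r"] r st by simp
  moreover have "integral {0..t - r} (\<lambda>r. f (\<gamma> r))
      = integral {0..s - r} (\<lambda>r. f (\<gamma> r)) + integral {s - r..t - r} (\<lambda>r. f (\<gamma> r))"
    using r st by (intro integral_split f\<gamma>) auto
  moreover have "- M * (t - r - (s - r)) \<le> integral {s - r..t - r} (\<lambda>r. f (\<gamma> r))"
  proof (rule integral_ge_const)
    show "continuous_on {s - r..t - r} (\<lambda>r. f (\<gamma> r))"
      by (rule continuous_on_subset[OF f\<gamma>]) (use r in auto)
    show "- M \<le> f (\<gamma> q)" for q using M[of "\<gamma> q"] by simp
  qed (use st in simp)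
  moreover have "\<bar>u (\<gamma> (s - r), r) - u0 (\<gamma> (s - r))\<bar> \<le> e / 3" "\<bar>u (\<gamma> (t - r), r) - u0 (\<gamma> (t - r))\<bar> \<le> e / 3"
    using \<tau>(2) r by auto
  moreover have "\<bar>u0 (\<gamma> (s - r)) - u0 (\<gamma> (t - r))\<bar> \<le> C * (t - s)"
  proof -
    have "dist (\<gamma> (s - r)) (\<gamma> (t - r)) \<le> 1 * dist (s - r) (t - r)"
      using r st by (intro lipschitz_onD[OF lip']) auto
    then have "C * dist (\<gamma> (s - r)) (\<gamma> (t - r)) \<le> C * (t - s)"
      using lipschitz_on_nonneg[OF u0] st by (intro mult_left_mono) (auto simp: dist_real_def)
    then show ?thesis using lipschitz_onD[OF u0, of "\<gamma> (s - r)" "\<gamma> (t - r)"] by (simp add: dist_real_def)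
  qed
  moreover have "- (M + C) * (t - s) = - M * (t - r - (s - r)) - C * (t - s)" by (simp add: algebra_simps)
  ultimately show "- (M + C) * (t - s) \<le> u (x, t) - u (x, s) + e" by linarith
qed

text \<open>To compare \<open>(x, t)\<close> with \<open>(y, s)\<close>, first jump from \<open>(x, t)\<close> to \<open>(y, t - h)\<close> with
\<open>h = dist x y + |t - s|\<close>. This lands at or before time \<open>s\<close>, so the bound on time increments leads
on to \<open>(y, s)\<close>.\<close>

lemma locally_lipschitz_if_subsolution:
  fixes u :: "'a::metric_space \<times> real \<Rightarrow> real"
  assumes ls: "length_space TYPE('a)" and sub: "curve_based_subsolution f T u"
    and f: "continuous_on UNIV f" and M: "\<And>x. \<bar>f x\<bar> \<le> M" and u: "continuous_on (spacetime T) u"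
    and "0 \<le> k" and time: "\<And>x s t. 0 < s \<Longrightarrow> s < t \<Longrightarrow> t < T \<Longrightarrow> - k * (t - s) \<le> u (x, t) - u (x, s)"
  shows "locally_lipschitz_on (spacetime T) u"
  unfolding locally_lipschitz_on_def
proof
  fix z :: "'a \<times> real" assume "z \<in> spacetime T"
  then obtain x0 t0 where z: "z = (x0, t0)" "0 < t0" by auto
  have "M \<ge> 0" using M[of x0] by simp
  define K where "K = 2 * (M + 2 * k)"
  have one_sided: "u p - u q \<le> K * dist p q"
    if p: "p \<in> ball z (t0 / 8) \<inter> spacetime T" and q: "q \<in> ball z (t0 / 8) \<inter> spacetime T" for p q
  proof -
    obtain x t where p_eq: "p = (x, t)" by (cases p)
    obtain y s where q_eq: "q = (y, s)" by (cases q)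
    have t: "0 < t" "t < T" and s: "0 < s" "s < T" using p q p_eq q_eq by auto
    define h where "h = dist x y + \<bar>t - s\<bar>"
    have h2: "h \<le> 2 * dist p q"
      using dist_fst_le[of p q] dist_snd_le[of p q] by (simp add: h_def p_eq q_eq dist_real_def)
    have "dist p q < t0 / 4"
      using dist_triangle3[of p q z] p q by simp
    moreover have "\<bar>t0 - t\<bar> < t0 / 8"
      using dist_snd_le[of z p] p by (simp add: z p_eq dist_real_def)
    ultimately have "h < t" using h2 by linarith
    show ?thesis
    proof (cases "h = 0")
      case True
      then have "p = q" unfolding h_def using zero_le_dist[of x y] by (simp add: p_eq q_eq add_nonneg_eq_0_iff)
      then show ?thesis by simp
    next
      case False
      then have "0 < h" by (simp add: h_def add_nonneg_nonneg less_le)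
      have "u (x, t) - u (y, t - h) \<le> M * h"
        by (rule subsolution_jump[OF ls sub f u \<open>t < T\<close> \<open>0 < h\<close> \<open>h < t\<close>, where \<eta> = "h + 1"])
           (use M in \<open>auto simp: h_def abs_le_iff\<close>)
      moreover have "u (y, t - h) - u (y, s) \<le> k * (2 * h)"
      proof -
        have "\<bar>t - s\<bar> \<le> h" by (simp add: h_def)
        then have "t - h \<le> s" "s - (t - h) \<le> 2 * h" by linarith+
        then have "u (y, t - h) - u (y, s) \<le> k * (s - (t - h))"
          using time[of "t - h" s y] \<open>h < t\<close> s by (cases "t - h = s") auto
        also have "\<dots> \<le> k * (2 * h)"
          using \<open>0 \<le> k\<close> \<open>s - (t - h) \<le> 2 * h\<close> by (rule mult_left_mono[rotated])
        finally show ?thesis .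
      qed
      moreover have "(M + 2 * k) * h \<le> (M + 2 * k) * (2 * dist p q)"
        using h2 \<open>M \<ge> 0\<close> \<open>0 \<le> k\<close> by (intro mult_left_mono) auto
      ultimately show ?thesis by (simp add: p_eq q_eq K_def algebra_simps)
    qed
  qed
  have "K-lipschitz_on (ball z (t0 / 8) \<inter> spacetime T) u"
  proof (rule lipschitz_onI)
    show "dist (u p) (u q) \<le> K * dist p q"
      if "p \<in> ball z (t0 / 8) \<inter> spacetime T" "q \<in> ball z (t0 / 8) \<inter> spacetime T" for p q
      using one_sided[OF that] one_sided[OF that(2,1)] by (simp add: dist_real_def dist_commute abs_le_iff)
    show "0 \<le> K" using \<open>M \<ge> 0\<close> \<open>0 \<le> k\<close> by (simp add: K_def)
  qed
  then show "\<exists>r>0. \<exists>C. C-lipschitz_on (ball z r \<inter> spacetime T) u"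
    using z(2) by (intro exI[of _ "t0 / 8"] conjI exI[of _ K]) auto
qed

section \<open>The equivalence\<close>

theorem theorem5p2:
  fixes f u0 :: "'a::complete_space \<Rightarrow> real"
    and u :: "'a \<times> real \<Rightarrow> real"
    and T :: real
  assumes "length_space TYPE('a)"
    and "T > 0"
    and "bounded (range f)" and "continuous_on UNIV f"
    and "bounded (range u0)" and "\<exists>C. C-lipschitz_on UNIV u0"
    and "continuous_on (UNIV \<times> {0..<T}) u"
    and "((\<lambda>t. SUP x. ereal \<bar>u (x, t) - u0 x\<bar>) \<longlongrightarrow> 0) (at_right 0)"
  shows "Monge_solution f T u \<longleftrightarrow> curve_based_solution f T u"
proof -
  note ls = assms(1) and f = assms(4)
  obtain M where M: "\<And>x. \<bar>f x\<bar> \<le> M" using assms(3) by (auto simp: bounded_iff)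
  then have "M \<ge> 0" by (meson abs_ge_zero order_trans)
  obtain C where C: "C-lipschitz_on UNIV u0" using assms(6) by blast
  have u: "continuous_on (spacetime T) u"
    by (rule continuous_on_subset[OF assms(7)]) auto
  have init: "\<exists>\<tau>>0. \<forall>r y. 0 < r \<and> r < \<tau> \<longrightarrow> \<bar>u (y, r) - u0 y\<bar> \<le> e" if "e > 0" for e
  proof -
    have "eventually (\<lambda>t. (SUP x. ereal \<bar>u (x, t) - u0 x\<bar>) < ereal e) (at_right 0)"
      using \<open>e > 0\<close> by (intro order_tendstoD(2)[OF assms(8)]) simp
    then obtain \<tau> where \<tau>: "\<tau> > 0" "\<And>r. 0 < r \<Longrightarrow> r < \<tau> \<Longrightarrow> (SUP x. ereal \<bar>u (x, r) - u0 x\<bar>) < ereal e"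
      unfolding eventually_at_right_field by auto
    have "\<bar>u (y, r) - u0 y\<bar> \<le> e" if "0 < r \<and> r < \<tau>" for r y
    proof -
      have "ereal \<bar>u (y, r) - u0 y\<bar> \<le> (SUP x. ereal \<bar>u (x, r) - u0 x\<bar>)" by (rule SUP_upper) simp
      also have "\<dots> < ereal e" using that by (intro \<tau>(2)) auto
      finally show ?thesis by simp
    qed
    with \<tau>(1) show ?thesis by blast
  qed
  show ?thesis
  proof
    assume "Monge_solution f T u"
    then obtain k where "\<forall>x. \<forall>t\<in>{0<..<T}. subslope (\<lambda>(y, s). u (y, s) + k * s) x t = ereal (f x + k)"
      unfolding Monge_solution_def by blast
    then have upper: "slope_upper f u x t" and lower: "slope_lower f u x t" if "t \<in> {0<..<T}" for x t
      using that unfolding subslope_eq_iff_slopes by blast+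
    show "curve_based_solution f T u"
      unfolding curve_based_solution_def
      by (intro conjI curve_based_subsolutionI[OF f M u upper]
          curve_based_supersolutionI[OF ls f M u upper lower init])
  next
    assume "curve_based_solution f T u"
    then have sub: "curve_based_subsolution f T u" and super: "curve_based_supersolution f T u"
      by (auto simp: curve_based_solution_def)
    define k where "k = M + C"
    have "k \<ge> 0" using \<open>M \<ge> 0\<close> lipschitz_on_nonneg[OF C] by (simp add: k_def)
    have time: "- k * (t - s) \<le> u (x, t) - u (x, s)" if "0 < s" "s < t" "t < T" for x s t
      using time_derivative_bound[OF sub super f M C init that] by (simp add: k_def)
    have "u \<in> S_class T k"
      using locally_lipschitz_if_subsolution[OF ls sub f M u \<open>k \<ge> 0\<close> time] time
      by (simp add: S_class_def)
    moreover have "k + (INF x. f x) \<ge> 0"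
    proof -
      have "- M \<le> (INF x. f x)"
        by (rule cINF_greatest) (use M in \<open>auto simp: abs_le_iff minus_le_iff\<close>)
      then show ?thesis using lipschitz_on_nonneg[OF C] by (simp add: k_def)
    qed
    moreover have "subslope (\<lambda>(y, s). u (y, s) + k * s) x t = ereal (f x + k)" if "t \<in> {0<..<T}" for x t
      unfolding subslope_eq_iff_slopes using that
      by (auto intro: slope_upper_if_subsolution[OF ls sub f u] slope_lower_if_supersolution[OF super f M])
    ultimately show "Monge_solution f T u"
      unfolding Monge_solution_def S_union_def using \<open>k \<ge> 0\<close> by auto
  qed
qed

end
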